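(* Let $S$ be a topological tree. Then for all integers $n \geq |S|$, $$0\leq \max_{\substack{|T|=n \\ T\text{ topological tree}}} \gamma(S,T) - J(S) \leq \frac{|S|(|S|-1)}{n}.$$ In particular, $$J(S)=\lim_{n\to \infty}\ \max_{\substack{|T|=n \\ T\text{ topological tree}}} \gamma(S,T).$$
   Context: A topological tree is a finite rooted tree in which every non-leaf vertex has outdegree (number of children) at least $2$; the single-vertex tree is allowed, its vertex being both root and leaf. Trees are considered up to isomorphism of rooted trees (unordered, unlabelled). $|T|$ denotes the number of leaves of $T$. A nonempty set $L$ of leaves of $T$ induces a topological tree: take the smallest subtree of $T$ connecting the leaves in $L$, rooted at the most recent common ancestor of $L$, and suppress (erase, joining the neighbours) all vertices of outdegree $1$. For topological trees $S,T$, $c(S,T)$ is the number of subsets of the leaf set of $T$ whose induced tree is isomorphic, as a rooted tree, to $S$, and $\gamma(S,T)=c(S,T)/\binom{|T|}{|S|}$ (for $|T|\ge |S|$). The inducibility of $S$ is $$J(S)=\limsup_{n\to\infty}\ \max_{\substack{|T|=n\\ T\text{ topological tree}}}\gamma(S,T).$$ *)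

theory Defs
  imports "HOL-Analysis.Analysis" "Graph_Theory.Graph_Theory"
begin

text \<open>
  A rooted tree is represented as a finite digraph whose arcs point from parent to child.  The
  root is then the only vertex from which every vertex can be reached, so it is determined by the
  digraph, and the digraph isomorphisms \<^const>\<open>digraph_iso\<close> between rooted trees are exactly their
  isomorphisms as rooted trees.
\<close>

definition rooted_tree :: "'a pair_pre_digraph \<Rightarrow> 'a \<Rightarrow> bool" where
  "rooted_tree T r \<longleftrightarrow>
     pair_fin_digraph T \<and> r \<in> pverts T \<and> (\<forall>v \<in> pverts T. \<exists>!p. pre_digraph.awalk T r p v)"

definition leaves :: "'a pair_pre_digraph \<Rightarrow> 'a set" where
  "leaves T = {v \<in> pverts T. out_degree T v = 0}"

definition num_leaves :: "'a pair_pre_digraph \<Rightarrow> nat" where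
  "num_leaves T = card (leaves T)"

definition topological_tree :: "'a pair_pre_digraph \<Rightarrow> bool" where
  "topological_tree T \<longleftrightarrow>
     (\<exists>r. rooted_tree T r) \<and> (\<forall>v \<in> pverts T - leaves T. out_degree T v \<ge> 2)"

text \<open>
  The smallest subtree connecting \<open>L\<close> (\<^const>\<open>connected\<close> ignores the direction of arcs).
  Connected vertex sets of a tree that share the nonempty set \<open>L\<close> have a connected intersection,
  so the intersection of all of them is the least one.  The subtree keeps the orientation of \<open>T\<close>,
  so its root is its topmost vertex, the most recent common ancestor of \<open>L\<close>.
\<close>

definition spanning_subtree ::
  "'a pair_pre_digraph \<Rightarrow> 'a set \<Rightarrow> ('a, 'a \<times> 'a) pre_digraph" where
  "spanning_subtree T L =
     with_proj T \<restriction> \<Inter>{W. L \<subseteq> W \<and> W \<subseteq> pverts T \<and> connected (with_proj T \<restriction> W)}"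

text \<open>
  Suppressing all vertices of outdegree \<open>1\<close>: the remaining vertices \<open>u\<close> and \<open>v\<close> are joined by an
  arc iff there is a nontrivial directed walk from \<open>u\<close> to \<open>v\<close> all of whose inner vertices are
  suppressed.
\<close>

definition suppress :: "('a, 'b) pre_digraph \<Rightarrow> 'a pair_pre_digraph" where
  "suppress G =
     (let K = {v \<in> verts G. out_degree G v \<noteq> 1} in
      \<lparr> pverts = K,
        parcs = {(u, v). u \<in> K \<and> v \<in> K \<and>
          (\<exists>p. p \<noteq> [] \<and> pre_digraph.awalk G u p v \<and>
               set (butlast (tl (pre_digraph.awalk_verts G u p))) \<inter> K = {})} \<rparr>)"

definition induced_tree :: "'a pair_pre_digraph \<Rightarrow> 'a set \<Rightarrow> 'a pair_pre_digraph" where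
  "induced_tree T L = suppress (spanning_subtree T L)"

definition copies :: "'a pair_pre_digraph \<Rightarrow> 'b pair_pre_digraph \<Rightarrow> nat" where
  "copies S T = card {L. L \<noteq> {} \<and> L \<subseteq> leaves T \<and> digraph_iso (induced_tree T L) S}"

definition tree_density :: "'a pair_pre_digraph \<Rightarrow> 'b pair_pre_digraph \<Rightarrow> real" where
  "tree_density S T = real (copies S T) / real (num_leaves T choose num_leaves S)"

text \<open>
  Every finite tree is isomorphic to one whose vertices are natural numbers, so the maximum runs
  over trees of that kind.  It is the maximum of a finite set, which is nonempty for \<open>n \<ge> 1\<close>.
\<close>

definition max_density :: "'a pair_pre_digraph \<Rightarrow> nat \<Rightarrow> real" where
  "max_density S n =
     Max {tree_density S T | T :: nat pair_pre_digraph. topological_tree T \<and> num_leaves T = n}"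

text \<open>
  The limit superior is taken in the extended reals because \<^const>\<open>limsup\<close> needs a complete linear
  order; it is finite because densities in trees with at least \<open>num_leaves S\<close> leaves lie between
  \<open>0\<close> and \<open>1\<close>.
\<close>

definition inducibility :: "'a pair_pre_digraph \<Rightarrow> real" where
  "inducibility S = real_of_ereal (limsup (\<lambda>n. ereal (max_density S n)))"

end

theory Submission
  imports Defs
begin

text \<open>
  A topological tree is determined by the laminar family of the leaf sets below its vertices, and
  the tree induced by \<open>L\<close> is the Hasse diagram of the traces of this family on \<open>L\<close>; conversely every
  laminar family containing the whole set and all singletons comes from a topological tree.  Copies
  can thus be counted in laminar families.

  Write \<open>k\<close> for the number of leaves of \<open>S\<close> and \<open>M n\<close> for the maximal density.  Deleting a
  random leaf preserves the expected density, so \<open>M\<close> is nonincreasing from \<open>k\<close> on and converges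
  to \<open>J\<close> from above.  Replacing every leaf of an optimal tree with \<open>n\<close> leaves by \<open>m\<close> leaves turns
  each copy into at least \<open>m ^ k\<close> copies, whence
  \<open>M (n * m) \<ge> M n * (n * (n - 1) * \<dots> * (n - k + 1) / n ^ k) \<ge> M n * (1 - k * (k - 1) / n)\<close>
  for all \<open>m\<close>.  Let \<open>m\<close> tend to infinity and use \<open>M n \<le> 1\<close>.
\<close>

section \<open>Rooted trees as relations\<close>

text \<open>Neither a vertex set nor a root is fixed, so that the locale also covers the arcs of a
  spanned subtree, where only the relation matters.\<close>

locale branching =
  fixes E :: "'a rel"
  assumes acyclic: "acyclic E"
    and parent_unique: "(u, v) \<in> E \<Longrightarrow> (u', v) \<in> E \<Longrightarrow> u = u'"
begin

lemma not_refl: "(u, u) \<notin> E\<^sup>+"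
  using acyclic by (simp add: acyclic_def)

lemma rtrancl_trancl_cycle: "(u, v) \<in> E\<^sup>* \<Longrightarrow> (v, u) \<notin> E\<^sup>+"
  using not_refl rtrancl_trancl_trancl by metis

lemma ancestor_of_parent: "(u, v) \<in> E\<^sup>+ \<Longrightarrow> (w, v) \<in> E \<Longrightarrow> (u, w) \<in> E\<^sup>*"
  by (metis parent_unique tranclD2)

text \<open>The ancestors of a vertex form a chain: an ancestor of \<open>z\<close> other than
  \<open>z\<close> itself is an ancestor of the unique parent of \<open>z\<close>, so induction
  along the path applies.\<close>

lemma ancestors_comparable:
  assumes "(u, w) \<in> E\<^sup>*" "(v, w) \<in> E\<^sup>*"
  shows "(u, v) \<in> E\<^sup>* \<or> (v, u) \<in> E\<^sup>*"
  using assms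
proof (induction arbitrary: v rule: rtrancl_induct)
  case (step y z)
  show ?case
  proof (cases "v = z")
    case True
    then show ?thesis using step.hyps by auto
  next
    case False
    then have "(v, z) \<in> E\<^sup>+" using step.prems by (simp add: rtrancl_eq_or_trancl)
    then show ?thesis using ancestor_of_parent step by blast
  qed
qed auto

text \<open>A common descendant would make the two siblings comparable. The upper one would then
  reach the parent of the lower one, which is also its own parent, and this closes a cycle.\<close>

lemma siblings_disjoint:
  assumes "(u, c) \<in> E" "(u, c') \<in> E" "c \<noteq> c'" "(c, w) \<in> E\<^sup>*"
  shows "(c', w) \<notin> E\<^sup>*"
proof
  assume "(c', w) \<in> E\<^sup>*"
  then consider "(c, c') \<in> E\<^sup>+" | "(c', c) \<in> E\<^sup>+"
    using ancestors_comparable assms by (metis rtranclD)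
  then show False
    by cases (use assms ancestor_of_parent rtrancl_trancl_cycle in blast)+
qed

text \<open>A vertex strictly between \<open>u\<close> and \<open>v\<close> is comparable with
  \<open>a\<close>; if it were strictly above \<open>a\<close>, it would reach the parent
  \<open>u\<close> and close a cycle. This is the induction step for the inner vertices of a
  walk.\<close>

lemma trancl_through_child:
  assumes "(u, a) \<in> E" "(a, v) \<in> E\<^sup>*"
  shows "(u, w) \<in> E\<^sup>+ \<and> (w, v) \<in> E\<^sup>+ \<longleftrightarrow> (a, w) \<in> E\<^sup>* \<and> (w, v) \<in> E\<^sup>+"
proof (intro iffI conjI)
  assume *: "(u, w) \<in> E\<^sup>+ \<and> (w, v) \<in> E\<^sup>+"
  then consider "(a, w) \<in> E\<^sup>*" | "(w, a) \<in> E\<^sup>+"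
    using ancestors_comparable[OF assms(2)] by (metis rtranclD trancl_into_rtrancl)
  then show "(a, w) \<in> E\<^sup>*"
    by cases (use * assms ancestor_of_parent rtrancl_trancl_cycle in blast)+
qed (use assms in auto)

end

section \<open>Walks in terms of reachability\<close>

lemma awalk_imp_rtrancl:
  assumes "pre_digraph.awalk G u p v"
  shows "(u, v) \<in> (arcs_ends G)\<^sup>*"
proof -
  have "set p \<subseteq> arcs G \<Longrightarrow> pre_digraph.cas G u p v \<Longrightarrow> (u, v) \<in> (arcs_ends G)\<^sup>*"
  proof (induction p arbitrary: u)
    case (Cons e p)
    then have "(u, head G e) \<in> arcs_ends G"
      by (auto simp: arcs_ends_def arc_to_ends_def pre_digraph.cas.simps)
    with Cons show ?case
      by (auto simp: pre_digraph.cas.simps intro: converse_rtrancl_into_rtrancl)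
  qed (simp add: pre_digraph.cas.simps)
  then show ?thesis
    using assms by (simp add: pre_digraph.awalk_def)
qed

text \<open>In a branching there is only one way down from \<open>u\<close> to \<open>v\<close>, so
  the inner vertices of a walk depend on its endpoints alone. This turns the walk condition in
  \<open>suppress\<close> into one about the tree order.\<close>

lemma (in wf_digraph) inner_awalk_verts_branching:
  assumes "branching (arcs_ends G)" "awalk u p v" "p \<noteq> []"
  shows "set (butlast (tl (awalk_verts u p))) =
    {w. (u, w) \<in> (arcs_ends G)\<^sup>+ \<and> (w, v) \<in> (arcs_ends G)\<^sup>+}"
proof -
  let ?E = "arcs_ends G"
  interpret branching ?E by fact
  \<comment> \<open>With the start vertex included, the vertex list grows by one element per
    prepended arc, which suits induction; the inner vertices of \<open>e # q\<close> are then
    obtained by applying the claim to \<open>q\<close>.\<close>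
  have *: "awalk u p v \<Longrightarrow>
    set (butlast (awalk_verts u p)) = {w. (u, w) \<in> ?E\<^sup>* \<and> (w, v) \<in> ?E\<^sup>+}" for u p
  proof (induction p arbitrary: u)
    case Nil
    then show ?case using rtrancl_trancl_cycle by (auto simp: awalk_simps)
  next
    case (Cons e p)
    then have e: "(u, head G e) \<in> ?E" and p: "awalk (head G e) p v" and u: "tail G e = u"
      by (auto simp: awalk_simps arcs_ends_def arc_to_ends_def)
    then have r: "(head G e, v) \<in> ?E\<^sup>*" by (blast dest: awalk_imp_rtrancl)
    have uv: "(u, v) \<in> ?E\<^sup>+" using e r by auto
    have "set (butlast (awalk_verts u (e # p))) = insert u {w. (head G e, w) \<in> ?E\<^sup>* \<and> (w, v) \<in> ?E\<^sup>+}"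
      using Cons.IH[OF p] u by simp
    also have "\<dots> = insert u {w. (u, w) \<in> ?E\<^sup>+ \<and> (w, v) \<in> ?E\<^sup>+}"
      using trancl_through_child[OF e r] by simp
    also have "\<dots> = {w. (u, w) \<in> ?E\<^sup>* \<and> (w, v) \<in> ?E\<^sup>+}"
      using uv by (auto dest: rtranclD)
    finally show ?case .
  qed
  obtain e q where p: "p = e # q" using assms(3) by (cases p) auto
  then have e: "(u, head G e) \<in> ?E" and q: "awalk (head G e) q v"
    using assms(2) by (auto simp: awalk_simps arcs_ends_def arc_to_ends_def)
  then have "(head G e, v) \<in> ?E\<^sup>*" by (blast dest: awalk_imp_rtrancl)
  then show ?thesis
    using *[OF q] trancl_through_child[OF e] p by simp
qed

locale arborescence = branching E for E :: "'a rel" +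
  fixes V :: "'a set" and r :: 'a
  assumes finite: "finite V"
    and arcs_in: "E \<subseteq> V \<times> V"
    and root_in: "r \<in> V"
    and root_reaches: "v \<in> V \<Longrightarrow> (r, v) \<in> E\<^sup>*"

text \<open>Two parents of a vertex, or a cycle through it, would yield two different walks from the
  root. Conversely, unique parents force two walks to the same vertex to agree arc by arc from their
  ends, and acyclicity makes them end at the root simultaneously.\<close>

lemma rooted_tree_iff_arborescence:
  "rooted_tree T r \<longleftrightarrow> arborescence (parcs T) (pverts T) r"
proof
  assume T: "rooted_tree T r"
  then interpret pair_fin_digraph T by (simp add: rooted_tree_def)
  have r: "r \<in> pverts T" and ex1: "\<And>v. v \<in> pverts T \<Longrightarrow> \<exists>!p. awalk r p v"
    using T by (auto simp: rooted_tree_def)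
  have in_verts: "parcs T \<subseteq> pverts T \<times> pverts T"
    by (auto dest: in_arcsD1 in_arcsD2)
  have parent: "u = u'" if "(u, v) \<in> parcs T" "(u', v) \<in> parcs T" for u u' v
  proof -
    have "u \<in> pverts T" "u' \<in> pverts T" "v \<in> pverts T" using that in_verts by auto
    then obtain p p' where "awalk r p u" "awalk r p' u'"
      using ex1 by meson
    then have "awalk r (p @ [(u, v)]) v" "awalk r (p' @ [(u', v)]) v"
      using that \<open>v \<in> pverts T\<close> by (auto simp: awalk_simps)
    then show ?thesis using ex1[OF \<open>v \<in> pverts T\<close>] by blast
  qed
  have acyc: "(u, u) \<notin> (parcs T)\<^sup>+" for u
  proof
    assume "(u, u) \<in> (parcs T)\<^sup>+"
    then obtain c where c: "awalk u c u" "c \<noteq> []"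
      using reachable1_awalk by auto
    then have u: "u \<in> pverts T" by auto
    then obtain p where p: "awalk r p u" using ex1 by meson
    then have "awalk r (p @ c) u" using c awalk_appendI by blast
    then have "p @ c = p" using p ex1[OF u] by blast
    then show False using c by simp
  qed
  have "(r, v) \<in> (parcs T)\<^sup>*" if "v \<in> pverts T" for v
    using ex1[OF that] awalk_imp_rtrancl[of "with_proj T" r _ v] by auto
  then show "arborescence (parcs T) (pverts T) r"
    using parent acyc in_verts r pair_finite_verts
    by unfold_locales (auto simp: acyclic_def)
next
  assume "arborescence (parcs T) (pverts T) r"
  then interpret A: arborescence "parcs T" "pverts T" r .
  have "finite (parcs T)" using A.arcs_in A.finite finite_subset by blast
  then interpret pair_fin_digraph T
    using A.arcs_in A.finite by unfold_locales auto
  have "p = q" if "awalk r p v" "awalk r q v" for p q v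
    using that
  proof (induction p arbitrary: q v rule: rev_induct)
    case Nil
    then have "v = r" by (simp add: awalk_simps)
    then show ?case
      using Nil.prems(2) A.not_refl[of r] reachable1_awalk[of r r] by auto
  next
    case (snoc e p)
    then have e: "e \<in> parcs T" "snd e = v" and p: "awalk r p (fst e)"
      by (auto simp: awalk_simps)
    have "q \<noteq> []"
    proof
      assume "q = []"
      then have "v = r" using snoc.prems(2) by (simp add: awalk_simps)
      then show False
        using snoc.prems(1) A.not_refl[of r] reachable1_awalk[of r r]
        by (metis Nil_is_append_conv not_Cons_self2)
    qed
    then obtain q' e' where q: "q = q' @ [e']" by (cases q rule: rev_exhaust) auto
    then have e': "e' \<in> parcs T" "snd e' = v" and q': "awalk r q' (fst e')"
      using snoc.prems(2) by (auto simp: awalk_simps)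
    have "fst e = fst e'" using e e' A.parent_unique by (metis prod.collapse)
    then show ?case using snoc.IH[OF p] q' q e e' by (metis prod.collapse)
  qed
  moreover have "\<exists>p. awalk r p v" if "v \<in> pverts T" for v
  proof -
    have "r = v \<or> (r, v) \<in> (parcs T)\<^sup>+" using A.root_reaches[OF that] by (metis rtranclD)
    then show ?thesis
    proof
      assume "r = v"
      then show ?thesis using that by (intro exI[of _ "[]"]) (simp add: awalk_simps)
    qed (use reachable1_awalk in auto)
  qed
  ultimately show "rooted_tree T r"
    unfolding rooted_tree_def using A.root_in pair_fin_digraph_axioms by auto
qed

lemma out_degree_pair: "out_degree (with_proj T) v = card (parcs T `` {v})"
proof -
  have "out_arcs (with_proj T) v = Pair v ` (parcs T `` {v})"
    by (auto simp: out_arcs_def)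
  then show ?thesis by (simp add: out_degree_def card_image inj_on_def)
qed

section \<open>Clusters and induced trees\<close>

definition cluster :: "'a rel \<Rightarrow> 'a \<Rightarrow> 'a set" where
  "cluster E v = {l. (v, l) \<in> E\<^sup>* \<and> E `` {l} = {}}"

text \<open>Vertices are kept apart from their labels so that one notion serves both the induced
  tree, whose vertices are labelled by traces, and the Hasse diagram of a set family. Arcs point
  from the larger to the smaller set, as from parent to child.\<close>

definition cover_graph :: "'a set \<Rightarrow> ('a \<Rightarrow> 'b set) \<Rightarrow> 'a pair_pre_digraph" where
  "cover_graph V D =
    \<lparr> pverts = V,
      parcs = {(u, v). u \<in> V \<and> v \<in> V \<and> D v \<subset> D u \<and> \<not> (\<exists>w \<in> V. D v \<subset> D w \<and> D w \<subset> D u)} \<rparr>"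

text \<open>The empty trace is removed because it belongs to the vertices without selected leaves
  below them.\<close>

definition restrict_family :: "'a set set \<Rightarrow> 'a set \<Rightarrow> 'a set set" where
  "restrict_family H L = (\<lambda>A. A \<inter> L) ` H - {{}}"

locale branching_arborescence = arborescence +
  assumes sibling: "(u, c) \<in> E \<Longrightarrow> \<exists>c'. c' \<noteq> c \<and> (u, c') \<in> E"
begin

abbreviation terminals :: "'a set" where
  "terminals \<equiv> {v \<in> V. E `` {v} = {}}"

lemma finite_arcs: "finite E"
  using arcs_in finite finite_subset by blast

lemma arcsD: "(u, v) \<in> E \<Longrightarrow> u \<in> V" "(u, v) \<in> E \<Longrightarrow> v \<in> V"
  using arcs_in by auto

lemma rtrancl_in: "(u, v) \<in> E\<^sup>* \<Longrightarrow> u \<in> V \<Longrightarrow> v \<in> V"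
  by (induction rule: rtrancl_induct) (auto dest: arcsD)

lemma induct_down [consumes 1, case_names step]:
  assumes "v \<in> V" and "\<And>v. v \<in> V \<Longrightarrow> (\<And>c. (v, c) \<in> E \<Longrightarrow> P c) \<Longrightarrow> P v"
  shows "P v"
proof -
  have "wf (E\<inverse>)"
    using finite_arcs acyclic by (rule finite_acyclic_wf_converse)
  then show ?thesis using assms(1)
    by (induction v rule: wf_induct_rule) (use assms(2) arcsD in blast)
qed

lemma cluster_mono: "(u, v) \<in> E\<^sup>* \<Longrightarrow> cluster E v \<subseteq> cluster E u"
  by (auto simp: cluster_def)

lemma cluster_subset: "v \<in> V \<Longrightarrow> cluster E v \<subseteq> terminals"
  by (auto simp: cluster_def intro: rtrancl_in)

lemma cluster_nonempty: "v \<in> V \<Longrightarrow> cluster E v \<noteq> {}"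
proof (induction rule: induct_down)
  case (step v)
  show ?case
  proof (cases "E `` {v} = {}")
    case True
    then have "v \<in> cluster E v" by (simp add: cluster_def)
    then show ?thesis by blast
  next
    case False
    then obtain c where "(v, c) \<in> E" by blast
    then show ?thesis using step cluster_mono by blast
  qed
qed

lemma cluster_terminal: "E `` {v} = {} \<Longrightarrow> cluster E v = {v}"
  by (auto simp: cluster_def elim: converse_rtranclE)

lemma cluster_root: "cluster E r = terminals"
  using cluster_subset[OF root_in] root_reaches by (auto simp: cluster_def)

lemma cluster_meet:
  "x \<in> cluster E u \<Longrightarrow> x \<in> cluster E v \<Longrightarrow> (u, v) \<in> E\<^sup>* \<or> (v, u) \<in> E\<^sup>*"
  using ancestors_comparable by (auto simp: cluster_def)

lemma cluster_child:
  assumes "x \<in> cluster E v" "(v, c) \<in> E"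
  obtains c' where "(v, c') \<in> E" "x \<in> cluster E c'"
  using assms by (auto simp: cluster_def elim: converse_rtranclE)

lemma cluster_siblings:
  "(u, c) \<in> E \<Longrightarrow> (u, c') \<in> E \<Longrightarrow> x \<in> cluster E c \<Longrightarrow> x \<in> cluster E c' \<Longrightarrow> c = c'"
  using siblings_disjoint by (auto simp: cluster_def)

end

section \<open>The subtree spanned by a set of leaves\<close>

locale leaf_selection = branching_arborescence +
  fixes L :: "'a set"
  assumes L_subset: "L \<subseteq> terminals" and L_nonempty: "L \<noteq> {}"
begin

abbreviation tr :: "'a \<Rightarrow> 'a set" where
  "tr v \<equiv> cluster E v \<inter> L"

text \<open>An explicit form of the vertex set of \<open>spanning_subtree\<close>: the second
  condition discards the proper ancestors of the most recent common ancestor of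
  \<open>L\<close>.\<close>

definition spanned :: "'a set" where
  "spanned = {v \<in> V. tr v \<noteq> {} \<and> (\<forall>c. (v, c) \<in> E \<longrightarrow> \<not> L \<subseteq> cluster E c)}"

text \<open>These are the lowest vertices among those with a given nonempty trace; by
  \<open>spanned_outdegree\<close> they are the ones that survive suppression.\<close>

definition kept :: "'a set" where
  "kept = {v \<in> V. tr v \<noteq> {} \<and> (\<forall>c. (v, c) \<in> E \<longrightarrow> tr c \<noteq> tr v)}"

lemma tr_mono: "(u, v) \<in> E\<^sup>* \<Longrightarrow> tr v \<subseteq> tr u"
  by (intro Int_mono cluster_mono order_refl)

lemma spanned_down:
  assumes "u \<in> spanned" "(u, w) \<in> E\<^sup>*" "tr w \<noteq> {}"
  shows "w \<in> spanned"
proof -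
  have "\<not> L \<subseteq> cluster E c" if wc: "(w, c) \<in> E" for c
  proof -
    obtain d where d: "(u, d) \<in> E" "(d, c) \<in> E\<^sup>*"
      using rtrancl_into_trancl1[OF assms(2) wc] by (meson tranclD)
    then have "\<not> L \<subseteq> cluster E d" using assms(1) by (auto simp: spanned_def)
    then show ?thesis using cluster_mono[OF d(2)] by blast
  qed
  moreover have "w \<in> V" using assms rtrancl_in by (simp add: spanned_def)
  ultimately show ?thesis using assms(3) by (simp add: spanned_def)
qed

lemma spanned_rtrancl:
  assumes "(u, v) \<in> E\<^sup>*" "u \<in> spanned" "v \<in> spanned"
  shows "(u, v) \<in> (E \<inter> spanned \<times> spanned)\<^sup>*"
  using assms
proof (induction rule: rtrancl_induct)
  case (step y z)
  have "tr z \<noteq> {}" using step.prems by (simp add: spanned_def)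
  then have "y \<in> spanned" using spanned_down[of u y] step.hyps step.prems tr_mono[of y z] by blast
  then show ?case using step by (meson IntI SigmaI rtrancl.rtrancl_into_rtrancl)
qed auto

lemma spanned_trancl:
  assumes "u \<in> spanned" "v \<in> spanned"
  shows "(u, v) \<in> (E \<inter> spanned \<times> spanned)\<^sup>+ \<longleftrightarrow> (u, v) \<in> E\<^sup>+"
proof
  assume "(u, v) \<in> E\<^sup>+"
  then show "(u, v) \<in> (E \<inter> spanned \<times> spanned)\<^sup>+"
    using spanned_rtrancl[of u v] assms not_refl by (metis rtranclD trancl_into_rtrancl)
qed (meson Int_lower1 subsetD trancl_mono)

text \<open>Starting at the root, one moves to a child above all of \<open>L\<close> for as long as
  there is one; the descent stops at the most recent common ancestor.\<close>

lemma spanned_top: "\<exists>m \<in> spanned. L \<subseteq> cluster E m"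
proof -
  have "v \<in> V \<Longrightarrow> L \<subseteq> cluster E v \<Longrightarrow> \<exists>m \<in> spanned. L \<subseteq> cluster E m" for v
  proof (induction rule: induct_down)
    case (step v)
    show ?case
    proof (cases "\<exists>c. (v, c) \<in> E \<and> L \<subseteq> cluster E c")
      case True
      then show ?thesis using step.IH by blast
    next
      case False
      have "cluster E v \<inter> L \<noteq> {}" using step.prems L_nonempty by blast
      then have "v \<in> spanned" using False step.hyps by (simp add: spanned_def)
      then show ?thesis using step.prems by blast
    qed
  qed
  then show ?thesis using root_in cluster_root L_subset by simp
qed

text \<open>Every vertex \<open>v\<close> of \<open>spanned\<close> is reached from the top vertex
  \<open>m\<close>: they share a leaf and are comparable, and if \<open>v\<close> were strictly
  above \<open>m\<close>, a child of \<open>v\<close> would be above all of \<open>L\<close>. Two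
  such descending paths are joined at \<open>m\<close>.\<close>

lemma spanned_connected: "connected (\<lparr> verts = spanned, arcs = E \<inter> spanned \<times> spanned, tail = fst, head = snd \<rparr>)"
proof -
  let ?R = "rtrancl_on spanned ((E \<inter> spanned \<times> spanned)\<^sup>s)"
  obtain m where m: "m \<in> spanned" "L \<subseteq> cluster E m" using spanned_top by blast
  have down: "(m, v) \<in> ?R" if v: "v \<in> spanned" for v
  proof -
    obtain x where x: "x \<in> cluster E v" "x \<in> L" using v by (auto simp: spanned_def)
    have "(m, v) \<in> E\<^sup>*"
    proof (rule ccontr)
      assume "(m, v) \<notin> E\<^sup>*"
      moreover have "(m, v) \<in> E\<^sup>* \<or> (v, m) \<in> E\<^sup>*" using cluster_meet[of x m v] x m by blast
      ultimately have "(v, m) \<in> E\<^sup>+" by (auto dest: rtranclD)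
      then obtain c where "(v, c) \<in> E" "(c, m) \<in> E\<^sup>*" by (meson tranclD)
      then have "L \<subseteq> cluster E c" using m(2) cluster_mono by (meson order_trans)
      then show False using v \<open>(v, c) \<in> E\<close> by (simp add: spanned_def)
    qed
    then have "(m, v) \<in> (E \<inter> spanned \<times> spanned)\<^sup>*" using spanned_rtrancl m v by blast
    then have "(m, v) \<in> rtrancl_on spanned (E \<inter> spanned \<times> spanned)"
      using m v by (intro rtrancl_consistent_rtrancl_on) auto
    then show ?thesis by (rule rtrancl_on_mono[rotated 2]) (auto simp: symcl_def)
  qed
  have "sym ?R" by (intro rtrancl_on_sym) (auto simp: sym_def symcl_def)
  then have "(u, v) \<in> ?R" if "u \<in> spanned" "v \<in> spanned" for u v
    using down[OF that(1)] down[OF that(2)] by (meson symD rtrancl_on_trans)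
  moreover have "arcs_ends \<lparr> verts = spanned, arcs = E \<inter> spanned \<times> spanned, tail = fst, head = snd \<rparr> = E \<inter> spanned \<times> spanned"
    by (auto simp: arcs_ends_conv)
  ultimately show ?thesis using m by (auto simp: connected_conv)
qed

text \<open>
  If a connected set misses a vertex \<open>v\<close> of \<open>spanned\<close>, then no arc inside the set leaves the part
  below a child of \<open>v\<close>, so that all of \<open>L\<close> lies below this child.
\<close>

lemma spanned_least:
  assumes W: "L \<subseteq> W" "W \<subseteq> V"
    and conn: "connected (\<lparr> verts = W, arcs = E \<inter> W \<times> W, tail = fst, head = snd \<rparr>)"
  shows "spanned \<subseteq> W"
proof
  fix v assume v: "v \<in> spanned"
  show "v \<in> W"
  proof (rule ccontr)
    assume "v \<notin> W"
    obtain x where x: "x \<in> cluster E v" "x \<in> L" using v by (auto simp: spanned_def)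
    then have "v \<noteq> x" using \<open>v \<notin> W\<close> W by blast
    then have "E `` {v} \<noteq> {}" using x by (auto simp: cluster_def elim: converse_rtranclE)
    then obtain c where c: "(v, c) \<in> E" "x \<in> cluster E c" using x cluster_child by blast
    have "arcs_ends \<lparr> verts = W, arcs = E \<inter> W \<times> W, tail = fst, head = snd \<rparr> = E \<inter> W \<times> W"
      by (auto simp: arcs_ends_conv)
    then have path: "(x, y) \<in> rtrancl_on W ((E \<inter> W \<times> W)\<^sup>s)" if "y \<in> L" for y
      using conn subsetD[OF W(1) x(2)] subsetD[OF W(1) that] by (simp add: connected_conv)
    have "(c, y) \<in> E\<^sup>*" if "(x, y) \<in> rtrancl_on W ((E \<inter> W \<times> W)\<^sup>s)" for y
      using that
    proof (induction rule: rtrancl_on_induct)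
      case base
      then show ?case using c by (simp add: cluster_def)
    next
      case (step a b)
      from step.hyps(2) consider "(a, b) \<in> E" | "(b, a) \<in> E" "b \<in> W" by (auto simp: symcl_def)
      then show ?case
      proof cases
        case 2
        then have "c \<noteq> a" using c \<open>v \<notin> W\<close> parent_unique by blast
        then have "(c, a) \<in> E\<^sup>+" using step.IH by (metis rtranclD)
        then show ?thesis using 2 ancestor_of_parent by blast
      qed (use step.IH in auto)
    qed
    then have "L \<subseteq> cluster E c" using path L_subset by (auto simp: cluster_def)
    then show False using v c by (simp add: spanned_def)
  qed
qed

lemma L_subset_spanned: "L \<subseteq> spanned"
proof
  fix l assume "l \<in> L"
  then have "l \<in> V" "E `` {l} = {}" using L_subset by auto
  then show "l \<in> spanned" using \<open>l \<in> L\<close> cluster_terminal[of l] by (auto simp: spanned_def)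
qed

lemma kept_subset_spanned: "kept \<subseteq> spanned"
proof
  fix v assume v: "v \<in> kept"
  have "tr c = tr v" if "(v, c) \<in> E" "L \<subseteq> cluster E c" for c
    using that tr_mono[of v c] by blast
  then show "v \<in> spanned" using v by (auto simp: kept_def spanned_def)
qed

text \<open>The children that stay in \<open>spanned\<close> are those with nonempty trace, and for
  a non-leaf vertex these traces partition its own. There is exactly one of them iff some child has
  the full trace.\<close>

lemma spanned_outdegree:
  assumes v: "v \<in> spanned"
  shows "card (E `` {v} \<inter> spanned) \<noteq> 1 \<longleftrightarrow> v \<in> kept"
proof -
  have children: "E `` {v} \<inter> spanned = {c. (v, c) \<in> E \<and> tr c \<noteq> {}}"
    using spanned_down[OF v] by (auto simp: spanned_def)
  have tr_v: "tr v \<noteq> {}" using v by (simp add: spanned_def)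
  have "card (E `` {v} \<inter> spanned) = 1 \<longleftrightarrow> (\<exists>c. (v, c) \<in> E \<and> tr c = tr v)"
  proof
    assume "card (E `` {v} \<inter> spanned) = 1"
    then obtain c where c: "{c. (v, c) \<in> E \<and> tr c \<noteq> {}} = {c}"
      using children by (metis card_1_singletonE)
    then have vc: "(v, c) \<in> E" by blast
    have "tr v \<subseteq> tr c"
    proof
      fix x assume x: "x \<in> tr v"
      then obtain c' where c': "(v, c') \<in> E" "x \<in> cluster E c'" using cluster_child vc by blast
      then have "c' \<in> {c. (v, c) \<in> E \<and> tr c \<noteq> {}}" using x by blast
      then show "x \<in> tr c" using c c' x by simp
    qed
    then show "\<exists>c. (v, c) \<in> E \<and> tr c = tr v" using vc tr_mono[of v c] by blast
  next
    assume "\<exists>c. (v, c) \<in> E \<and> tr c = tr v"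
    then obtain c where c: "(v, c) \<in> E" "tr c = tr v" by blast
    then have "{c. (v, c) \<in> E \<and> tr c \<noteq> {}} = {c}"
      using cluster_siblings tr_mono[of v] tr_v by blast
    then show "card (E `` {v} \<inter> spanned) = 1" using children by simp
  qed
  then show ?thesis using v by (auto simp: kept_def spanned_def)
qed

text \<open>Going down from a kept vertex loses part of the trace at the very first arc, hence
  strictness. Conversely, nested nonempty traces share a leaf, so their vertices are
  comparable.\<close>

lemma kept_trancl:
  assumes "u \<in> kept" "v \<in> kept"
  shows "(u, v) \<in> E\<^sup>+ \<longleftrightarrow> tr v \<subset> tr u"
proof
  assume "(u, v) \<in> E\<^sup>+"
  then obtain c where "(u, c) \<in> E" "(c, v) \<in> E\<^sup>*" by (meson tranclD)
  then show "tr v \<subset> tr u" using assms tr_mono[of u c] tr_mono[of c v] unfolding kept_def by blast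
next
  assume *: "tr v \<subset> tr u"
  obtain x where "x \<in> tr v" using assms unfolding kept_def by blast
  then have "(u, v) \<in> E\<^sup>* \<or> (v, u) \<in> E\<^sup>*" using * cluster_meet by blast
  then show "(u, v) \<in> E\<^sup>+" using * tr_mono[of v u] by (metis psubsetE rtranclD)
qed

lemma kept_inj: "inj_on tr kept"
proof (rule inj_onI)
  fix u v assume uv: "u \<in> kept" "v \<in> kept" "tr u = tr v"
  obtain x where "x \<in> tr v" using uv unfolding kept_def by blast
  then have "(u, v) \<in> E\<^sup>* \<or> (v, u) \<in> E\<^sup>*" using uv cluster_meet by blast
  then show "u = v" using kept_trancl uv by (metis psubset_eq rtranclD)
qed

text \<open>Passing to a child with the same trace, as long as one exists, ends at a kept vertex, so
  that suppression loses no trace.\<close>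

lemma tr_kept: "tr ` kept = restrict_family (cluster E ` V) L"
proof -
  have "v \<in> V \<Longrightarrow> tr v \<noteq> {} \<Longrightarrow> tr v \<in> tr ` kept" for v
  proof (induction rule: induct_down)
    case (step v)
    show ?case
    proof (cases "\<exists>c. (v, c) \<in> E \<and> tr c = tr v")
      case True
      then obtain c where "(v, c) \<in> E" "tr c = tr v" by blast
      then show ?thesis using step.IH[of c] step.prems by simp
    next
      case False
      then have "v \<in> kept" using step.hyps step.prems by (simp add: kept_def)
      then show ?thesis by blast
    qed
  qed
  then show ?thesis by (auto simp: restrict_family_def kept_def)
qed

end

section \<open>Translation of topological and induced trees\<close>

lemma topological_tree_iff:
  "topological_tree T \<longleftrightarrow> (\<exists>r. branching_arborescence (parcs T) (pverts T) r)"
proof -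
  have iff: "(\<forall>v \<in> pverts T - leaves T. 2 \<le> out_degree (with_proj T) v) \<longleftrightarrow>
      (\<forall>u c. (u, c) \<in> parcs T \<longrightarrow> (\<exists>c'. c' \<noteq> c \<and> (u, c') \<in> parcs T))"
    if "arborescence (parcs T) (pverts T) r" for r
  proof -
    interpret arborescence "parcs T" "pverts T" r by fact
    have fin: "finite (parcs T `` {v})" for v
      using finite arcs_in by (auto intro: finite_subset[of _ "pverts T"])
    have two: "2 \<le> card (parcs T `` {v}) \<longleftrightarrow>
        (\<exists>c c'. c' \<noteq> c \<and> (v, c) \<in> parcs T \<and> (v, c') \<in> parcs T)" for v
    proof -
      have "2 \<le> card (parcs T `` {v}) \<longleftrightarrow> \<not> card (parcs T `` {v}) \<le> Suc 0" by linarith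
      then show ?thesis unfolding card_le_Suc0_iff_eq[OF fin] by blast
    qed
    have nonleaf: "v \<in> pverts T - leaves T \<longleftrightarrow> (\<exists>c. (v, c) \<in> parcs T)" for v
      using arcs_in fin[of v] by (auto simp: leaves_def out_degree_pair)
    show ?thesis
    proof (intro iffI allI impI ballI)
      fix u c
      assume "\<forall>v \<in> pverts T - leaves T. 2 \<le> out_degree (with_proj T) v" "(u, c) \<in> parcs T"
      then have "2 \<le> card (parcs T `` {u})" using nonleaf[of u] out_degree_pair by metis
      then obtain d d' where "d \<noteq> d'" "(u, d) \<in> parcs T" "(u, d') \<in> parcs T"
        unfolding two by blast
      then show "\<exists>c'. c' \<noteq> c \<and> (u, c') \<in> parcs T" by (cases "d = c") auto
    next
      fix v
      assume sib: "\<forall>u c. (u, c) \<in> parcs T \<longrightarrow> (\<exists>c'. c' \<noteq> c \<and> (u, c') \<in> parcs T)"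
        and "v \<in> pverts T - leaves T"
      then obtain c where "(v, c) \<in> parcs T" using nonleaf by blast
      then show "2 \<le> out_degree (with_proj T) v" using sib unfolding out_degree_pair two by blast
    qed
  qed
  show ?thesis
  proof
    assume "topological_tree T"
    then obtain r where r: "arborescence (parcs T) (pverts T) r"
      and "\<forall>v \<in> pverts T - leaves T. 2 \<le> out_degree (with_proj T) v"
      unfolding topological_tree_def rooted_tree_iff_arborescence by blast
    then have "branching_arborescence (parcs T) (pverts T) r"
      using iff[OF r] by (intro branching_arborescence.intro branching_arborescence_axioms.intro) auto
    then show "\<exists>r. branching_arborescence (parcs T) (pverts T) r" ..
  next
    assume "\<exists>r. branching_arborescence (parcs T) (pverts T) r"
    then obtain r where "branching_arborescence (parcs T) (pverts T) r" ..
    then interpret branching_arborescence "parcs T" "pverts T" r .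
    show "topological_tree T"
      unfolding topological_tree_def rooted_tree_iff_arborescence
      using iff[OF arborescence_axioms] sibling arborescence_axioms by blast
  qed
qed

lemma leaves_eq:
  assumes "finite (parcs T)"
  shows "leaves T = {v \<in> pverts T. parcs T `` {v} = {}}"
  using assms by (auto simp: leaves_def out_degree_pair finite_Image)

text \<open>On kept vertices the order of the spanned subtree is strict inclusion of traces. A walk
  whose inner vertices are all suppressed therefore exists exactly when one trace covers the
  other.\<close>

lemma induced_tree_eq:
  assumes "leaf_selection (parcs T) (pverts T) r L"
  shows "induced_tree T L =
    cover_graph (leaf_selection.kept (parcs T) (pverts T) L) (\<lambda>v. cluster (parcs T) v \<inter> L)"
proof -
  interpret leaf_selection "parcs T" "pverts T" r L by fact
  let ?E = "parcs T" and ?G = "with_proj T \<restriction> spanned"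
  have induce: "with_proj T \<restriction> W =
    \<lparr> verts = W, arcs = parcs T \<inter> W \<times> W, tail = fst, head = snd \<rparr>" for W
    by (auto simp: induce_subgraph_def)
  have spanned_in: "spanned \<subseteq> pverts T" by (auto simp: spanned_def)
  have "\<Inter>{W. L \<subseteq> W \<and> W \<subseteq> pverts T \<and> connected (with_proj T \<restriction> W)} = spanned"
    using spanned_connected spanned_least L_subset_spanned spanned_in unfolding induce by blast
  then have span: "spanning_subtree T L = ?G" by (simp add: spanning_subtree_def)
  have ends: "arcs_ends ?G = ?E \<inter> spanned \<times> spanned"
    by (auto simp: induce arcs_ends_conv)
  interpret G: wf_digraph ?G by unfold_locales (auto simp: induce)
  have "out_arcs ?G v = Pair v ` (?E `` {v} \<inter> spanned)" if "v \<in> spanned" for v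
    using that by (auto simp: out_arcs_def induce)
  then have outdeg: "out_degree ?G v = card (?E `` {v} \<inter> spanned)" if "v \<in> spanned" for v
    using that by (simp add: out_degree_def card_image inj_on_def)
  have "v \<in> spanned \<and> out_degree ?G v \<noteq> 1 \<longleftrightarrow> v \<in> kept" for v
    using outdeg[of v] spanned_outdegree[of v] kept_subset_spanned by (cases "v \<in> spanned") auto
  then have K: "{v \<in> verts ?G. out_degree ?G v \<noteq> 1} = kept"
    by simp
  have br: "branching (arcs_ends ?G)"
    unfolding ends using acyclic_subset[OF acyclic, of "?E \<inter> spanned \<times> spanned"] parent_unique
    by unfold_locales blast+
  have arcs: "(\<exists>p. p \<noteq> [] \<and> G.awalk u p v \<and> set (butlast (tl (G.awalk_verts u p))) \<inter> kept = {}) \<longleftrightarrow>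
      tr v \<subset> tr u \<and> \<not> (\<exists>w \<in> kept. tr v \<subset> tr w \<and> tr w \<subset> tr u)" (is "?P \<longleftrightarrow> ?Q")
    if uv: "u \<in> kept" "v \<in> kept" for u v
  proof -
    have E: "(a, b) \<in> (arcs_ends ?G)\<^sup>+ \<longleftrightarrow> tr b \<subset> tr a" if "a \<in> kept" "b \<in> kept" for a b
    proof -
      have "a \<in> spanned" "b \<in> spanned" using that kept_subset_spanned by auto
      then show ?thesis unfolding ends using spanned_trancl[of a b] kept_trancl[OF that] by simp
    qed
    \<comment> \<open>The inner vertices are the same for all walks from \<open>u\<close> to
      \<open>v\<close>, so the condition on them separates from the existence of a walk.\<close>
    have "?P \<longleftrightarrow> (\<exists>p. p \<noteq> [] \<and> G.awalk u p v) \<and>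
        {w. (u, w) \<in> (arcs_ends ?G)\<^sup>+ \<and> (w, v) \<in> (arcs_ends ?G)\<^sup>+} \<inter> kept = {}"
      using G.inner_awalk_verts_branching[OF br, of u _ v] by auto
    also have "(\<exists>p. p \<noteq> [] \<and> G.awalk u p v) \<longleftrightarrow> tr v \<subset> tr u"
      unfolding E[OF uv, symmetric] G.reachable1_awalk by blast
    also have "{w. (u, w) \<in> (arcs_ends ?G)\<^sup>+ \<and> (w, v) \<in> (arcs_ends ?G)\<^sup>+} \<inter> kept =
        {w \<in> kept. tr v \<subset> tr w \<and> tr w \<subset> tr u}"
      using E uv by (intro set_eqI) (simp add: conj_commute cong: conj_cong)
    finally show ?thesis by auto
  qed
  show ?thesis
    unfolding induced_tree_def span suppress_def Let_def K cover_graph_def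
    by (simp add: arcs cong: conj_cong)
qed

section \<open>Hierarchies\<close>

text \<open>The arcs depend only on the strict order of the labels, so an order isomorphism between
  the labellings is already a digraph isomorphism.\<close>

lemma cover_graph_iso:
  assumes f: "bij_betw f V V'"
    and less: "\<And>u v. u \<in> V \<Longrightarrow> v \<in> V \<Longrightarrow> D v \<subset> D u \<longleftrightarrow> D' (f v) \<subset> D' (f u)"
  shows "digraph_iso (with_proj (cover_graph V D)) (with_proj (cover_graph V' D'))"
proof -
  let ?G = "with_proj (cover_graph V D)"
  define h where "h = \<lparr> iso_verts = f, iso_arcs = map_prod f f, iso_head = snd, iso_tail = fst \<rparr>"
  have inj: "inj_on f V" and V': "V' = f ` V" using f by (auto simp: bij_betw_def)
  have sub: "parcs (cover_graph V D) \<subseteq> V \<times> V" by (auto simp: cover_graph_def)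
  have "inj_on (map_prod f f) (V \<times> V)" using inj by (simp add: map_prod_inj_on)
  then have "inj_on (map_prod f f) (parcs (cover_graph V D))" using sub inj_on_subset by blast
  moreover have "wf_digraph ?G" by unfold_locales (auto simp: cover_graph_def)
  ultimately have "pre_digraph.digraph_isomorphism ?G h"
    using inj unfolding pre_digraph.digraph_isomorphism_def
    by (auto simp: h_def) (auto simp: cover_graph_def)
  moreover have "with_proj (cover_graph V' D') = app_iso h ?G"
  proof -
    have arc: "(f u, f v) \<in> parcs (cover_graph V' D') \<longleftrightarrow> (u, v) \<in> parcs (cover_graph V D)"
      if "u \<in> V" "v \<in> V" for u v
      using that less by (simp add: cover_graph_def V')
    have "parcs (cover_graph V' D') = map_prod f f ` parcs (cover_graph V D)"
    proof (intro set_eqI iffI)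
      fix e assume e: "e \<in> parcs (cover_graph V' D')"
      then obtain u v where "u \<in> V" "v \<in> V" "e = (f u, f v)"
        by (auto simp: cover_graph_def V')
      then show "e \<in> map_prod f f ` parcs (cover_graph V D)"
        using e arc by (intro image_eqI[of _ _ "(u, v)"]) auto
    next
      fix e assume "e \<in> map_prod f f ` parcs (cover_graph V D)"
      then show "e \<in> parcs (cover_graph V' D')" using arc sub by auto
    qed
    then show ?thesis
      using V' by (simp add: with_proj_def app_iso_def h_def cover_graph_def)
  qed
  ultimately show ?thesis unfolding digraph_iso_def by blast
qed

lemma wf_cover_graph: "wf_digraph (with_proj (cover_graph V D))"
  by unfold_locales (auto simp: cover_graph_def)

lemma num_leaves_iso:
  assumes "wf_digraph (with_proj G)" "digraph_iso (with_proj G) (with_proj S)"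
  shows "num_leaves S = num_leaves G"
proof -
  obtain h where h: "pre_digraph.digraph_isomorphism (with_proj G) h"
    and S: "with_proj S = app_iso h (with_proj G)"
    using assms by (auto simp: digraph_iso_def)
  interpret wf_digraph "with_proj G" by fact
  have "pverts S = iso_verts h ` pverts G"
    using arg_cong[OF S, of verts] by simp
  moreover have "out_degree (with_proj S) (iso_verts h v) = out_degree (with_proj G) v" if "v \<in> pverts G" for v
    using out_degree_app_iso_eq[OF h] that by (simp add: S)
  ultimately have "leaves S = iso_verts h ` leaves G" by (auto simp: leaves_def)
  moreover have "inj_on (iso_verts h) (leaves G)"
    using digraph_isomorphism_inj_on_verts[OF h] by (rule inj_on_subset) (auto simp: leaves_def)
  ultimately show ?thesis by (simp add: num_leaves_def card_image)
qed

section \<open>Laminar families and their traces\<close>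

abbreviation hasse :: "'a set set \<Rightarrow> 'a set pair_pre_digraph" where
  "hasse H \<equiv> cover_graph H (\<lambda>A. A)"

text \<open>This is the cluster system of a rooted tree with leaf set \<open>X\<close>, as used in
  phylogenetics.\<close>

definition hierarchy :: "'a set \<Rightarrow> 'a set set \<Rightarrow> bool" where
  "hierarchy X H \<longleftrightarrow> finite X \<and> X \<in> H \<and> (\<forall>A \<in> H. A \<noteq> {} \<and> A \<subseteq> X) \<and> (\<forall>x \<in> X. {x} \<in> H) \<and>
    (\<forall>A \<in> H. \<forall>B \<in> H. A \<inter> B = {} \<or> A \<subseteq> B \<or> B \<subseteq> A)"

lemma hierarchyD:
  assumes "hierarchy X H"
  shows "finite X" "X \<in> H" "A \<in> H \<Longrightarrow> A \<noteq> {}" "A \<in> H \<Longrightarrow> A \<subseteq> X" "x \<in> X \<Longrightarrow> {x} \<in> H"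
  using assms by (simp_all add: hierarchy_def)

lemma hierarchy_laminar:
  assumes "hierarchy X H" "A \<in> H" "B \<in> H" "x \<in> A" "x \<in> B"
  shows "A \<subseteq> B \<or> B \<subseteq> A"
proof -
  have "A \<inter> B = {} \<or> A \<subseteq> B \<or> B \<subseteq> A" using assms(1-3) by (simp add: hierarchy_def)
  then show ?thesis using assms(4,5) by blast
qed

lemma hierarchy_finite: "hierarchy X H \<Longrightarrow> finite H"
  using hierarchyD(1,4) by (metis Pow_iff finite_Pow_iff finite_subset subsetI)

lemma restrict_family_iff: "B \<in> restrict_family H L \<longleftrightarrow> B \<noteq> {} \<and> (\<exists>A \<in> H. B = A \<inter> L)"
  by (auto simp: restrict_family_def)

lemma restrict_family_subset: "B \<in> restrict_family H L \<Longrightarrow> B \<subseteq> L"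
  by (auto simp: restrict_family_iff)

lemma hierarchy_restrict:
  assumes H: "hierarchy X H" and L: "L \<subseteq> X" "L \<noteq> {}"
  shows "hierarchy L (restrict_family H L)"
  unfolding hierarchy_def
proof (intro conjI ballI)
  show "finite L" using L hierarchyD(1)[OF H] finite_subset by blast
  have "L = X \<inter> L" using L by blast
  then show "L \<in> restrict_family H L"
    using L hierarchyD(2)[OF H] unfolding restrict_family_iff by blast
next
  fix x assume x: "x \<in> L"
  then have "{x} \<in> H" using hierarchyD(5)[OF H] L by blast
  moreover have "{x} = {x} \<inter> L" using x by blast
  ultimately show "{x} \<in> restrict_family H L" unfolding restrict_family_iff by blast
next
  fix A B assume "A \<in> restrict_family H L" "B \<in> restrict_family H L"
  then obtain A' B' where *: "A' \<in> H" "A = A' \<inter> L" "B' \<in> H" "B = B' \<inter> L"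
    by (auto simp: restrict_family_iff)
  show "A \<inter> B = {} \<or> A \<subseteq> B \<or> B \<subseteq> A"
  proof (cases "A \<inter> B = {}")
    case False
    then obtain x where "x \<in> A'" "x \<in> B'" using * by blast
    then show ?thesis using hierarchy_laminar[OF H *(1,3)] * by blast
  qed simp
qed (auto simp: restrict_family_iff)

lemma restrict_restrict:
  assumes "L \<subseteq> M"
  shows "restrict_family (restrict_family H M) L = restrict_family H L"
proof (intro set_eqI iffI)
  fix B assume "B \<in> restrict_family (restrict_family H M) L"
  then obtain C where "B \<noteq> {}" "C \<in> restrict_family H M" "B = C \<inter> L"
    unfolding restrict_family_iff[of B] by blast
  then obtain A where "B \<noteq> {}" "A \<in> H" "B = A \<inter> M \<inter> L"
    unfolding restrict_family_iff by blast
  moreover have "A \<inter> M \<inter> L = A \<inter> L" using assms by blast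
  ultimately show "B \<in> restrict_family H L" by (auto simp: restrict_family_iff)
next
  fix B assume "B \<in> restrict_family H L"
  then obtain A where A: "B \<noteq> {}" "A \<in> H" "B = A \<inter> L" by (auto simp: restrict_family_iff)
  then have "A \<inter> M \<in> restrict_family H M" "B = A \<inter> M \<inter> L"
    using assms unfolding restrict_family_iff by blast+
  then show "B \<in> restrict_family (restrict_family H M) L"
    using A(1) unfolding restrict_family_iff[of B "restrict_family H M"] by blast
qed

lemma restrict_family_image:
  assumes "inj_on f X" "\<And>A. A \<in> H \<Longrightarrow> A \<subseteq> X" "L \<subseteq> X"
  shows "restrict_family ((`) f ` H) (f ` L) = (`) f ` restrict_family H L"
proof (rule set_eqI)
  fix B
  have "f ` A \<inter> f ` L = f ` (A \<inter> L)" if "A \<in> H" for A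
    using inj_on_image_Int[OF assms(1)] assms(2)[OF that] assms(3) by simp
  then have "B \<in> restrict_family ((`) f ` H) (f ` L) \<longleftrightarrow> B \<noteq> {} \<and> (\<exists>A \<in> H. B = f ` (A \<inter> L))"
    by (simp add: restrict_family_iff)
  also have "\<dots> \<longleftrightarrow> (\<exists>C. (C \<noteq> {} \<and> (\<exists>A \<in> H. C = A \<inter> L)) \<and> B = f ` C)"
    by blast
  also have "\<dots> \<longleftrightarrow> B \<in> (`) f ` restrict_family H L"
    unfolding image_iff Bex_def restrict_family_iff ..
  finally show "B \<in> restrict_family ((`) f ` H) (f ` L) \<longleftrightarrow> B \<in> (`) f ` restrict_family H L" .
qed

lemma hasse_image_iso:
  assumes "inj_on f X" "\<And>A. A \<in> H \<Longrightarrow> A \<subseteq> X"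
  shows "digraph_iso (with_proj (hasse H)) (with_proj (hasse ((`) f ` H)))"
proof (rule cover_graph_iso)
  have "inj_on ((`) f) H"
    using inj_on_image_Pow[OF assms(1)] by (rule inj_on_subset) (use assms(2) in auto)
  then show "bij_betw ((`) f) H ((`) f ` H)" by (simp add: bij_betw_def)
  fix A B assume "A \<in> H" "B \<in> H"
  then have "A \<subseteq> X" "B \<subseteq> X" using assms(2) by auto
  then show "B \<subset> A \<longleftrightarrow> f ` B \<subset> f ` A"
    by (simp add: less_le_not_le inj_on_image_subset_iff[OF assms(1)])
qed

lemma digraph_iso_left_cong:
  assumes "wf_digraph G" "digraph_iso G G'"
  shows "digraph_iso G S \<longleftrightarrow> digraph_iso G' S"
  using digraph_iso_trans[OF digraph_iso_swap[OF assms]] digraph_iso_trans[OF assms(2)] by (rule iffI)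

definition occurrences :: "'s pair_pre_digraph \<Rightarrow> 'a set \<Rightarrow> 'a set set \<Rightarrow> 'a set set" where
  "occurrences S X H =
    {L. L \<noteq> {} \<and> L \<subseteq> X \<and> digraph_iso (with_proj (hasse (restrict_family H L))) (with_proj S)}"

text \<open>Needed because realizing a family as a tree renames its points to leaves.\<close>

lemma occurrences_image:
  assumes f: "inj_on f X" and H: "\<And>A. A \<in> H \<Longrightarrow> A \<subseteq> X"
  shows "card (occurrences S (f ` X) ((`) f ` H)) = card (occurrences S X H)"
proof -
  have iso: "digraph_iso (with_proj (hasse (restrict_family ((`) f ` H) (f ` L)))) (with_proj S) \<longleftrightarrow>
     digraph_iso (with_proj (hasse (restrict_family H L))) (with_proj S)" if L: "L \<subseteq> X" for L
  proof -
    have "A \<subseteq> X" if "A \<in> restrict_family H L" for A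
      using restrict_family_subset[OF that] L by simp
    then have i: "digraph_iso (with_proj (hasse (restrict_family H L)))
        (with_proj (hasse ((`) f ` restrict_family H L)))"
      by (rule hasse_image_iso[OF f])
    have "restrict_family ((`) f ` H) (f ` L) = (`) f ` restrict_family H L"
      using f H L by (rule restrict_family_image)
    then show ?thesis
      using digraph_iso_left_cong[OF wf_cover_graph i, of "with_proj S"] by simp
  qed
  have "occurrences S (f ` X) ((`) f ` H) = (`) f ` occurrences S X H"
  proof (intro set_eqI iffI)
    fix M assume M: "M \<in> occurrences S (f ` X) ((`) f ` H)"
    then obtain L where "L \<subseteq> X" "M = f ` L" by (auto simp: occurrences_def subset_image_iff)
    then show "M \<in> (`) f ` occurrences S X H"
      using M iso[of L] by (auto simp: occurrences_def)
  next
    fix M assume "M \<in> (`) f ` occurrences S X H"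
    then obtain L where "L \<in> occurrences S X H" "M = f ` L" by blast
    then show "M \<in> occurrences S (f ` X) ((`) f ` H)"
      using iso[of L] by (auto simp: occurrences_def)
  qed
  moreover have "inj_on ((`) f) (occurrences S X H)"
    using inj_on_image_Pow[OF f] by (rule inj_on_subset) (auto simp: occurrences_def)
  ultimately show ?thesis by (simp add: card_image)
qed

section \<open>Trees built from hierarchies\<close>

locale covering =
  fixes V :: "'v set" and D :: "'v \<Rightarrow> 'a set" and X :: "'a set"
  assumes V_finite: "finite V" and D_inj: "inj_on D V" and D_hierarchy: "hierarchy X (D ` V)"
begin

abbreviation E :: "'v rel" where
  "E \<equiv> parcs (cover_graph V D)"

lemma E_iff: "(u, v) \<in> E \<longleftrightarrow>
    u \<in> V \<and> v \<in> V \<and> D v \<subset> D u \<and> \<not> (\<exists>w \<in> V. D v \<subset> D w \<and> D w \<subset> D u)"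
  by (simp add: cover_graph_def)

text \<open>A strict inclusion is refined by intermediate sets until only coverings remain; the
  number of vertices strictly between the endpoints drops for both halves.\<close>

lemma E_trancl:
  "(u, v) \<in> E\<^sup>+ \<longleftrightarrow> u \<in> V \<and> v \<in> V \<and> D v \<subset> D u"
proof
  assume "(u, v) \<in> E\<^sup>+"
  then show "u \<in> V \<and> v \<in> V \<and> D v \<subset> D u"
    by (induction rule: trancl_induct) (auto simp: E_iff)
next
  assume "u \<in> V \<and> v \<in> V \<and> D v \<subset> D u"
  then show "(u, v) \<in> E\<^sup>+"
  proof (induction "card {w \<in> V. D v \<subset> D w \<and> D w \<subset> D u}" arbitrary: u v rule: less_induct)
    case less
    show ?case
    proof (cases "\<exists>w \<in> V. D v \<subset> D w \<and> D w \<subset> D u")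
      case False
      then show ?thesis using less.prems by (intro r_into_trancl) (simp add: E_iff)
    next
      case True
      then obtain w where w: "w \<in> V" "D v \<subset> D w" "D w \<subset> D u" by blast
      have "card {x \<in> V. D v \<subset> D x \<and> D x \<subset> D w} < card {x \<in> V. D v \<subset> D x \<and> D x \<subset> D u}"
        using w V_finite by (intro psubset_card_mono) auto
      moreover have "card {x \<in> V. D w \<subset> D x \<and> D x \<subset> D u} < card {x \<in> V. D v \<subset> D x \<and> D x \<subset> D u}"
        using w V_finite by (intro psubset_card_mono) auto
      ultimately have "(u, w) \<in> E\<^sup>+" "(w, v) \<in> E\<^sup>+"
        using less.hyps less.prems w by auto
      then show ?thesis by simp
    qed
  qed
qed

lemma E_rtrancl: "u \<in> V \<Longrightarrow> v \<in> V \<Longrightarrow> (u, v) \<in> E\<^sup>* \<longleftrightarrow> D v \<subseteq> D u"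
  using E_trancl[of u v] D_inj by (auto simp: rtrancl_eq_or_trancl inj_on_def)

definition leaf :: "'a \<Rightarrow> 'v" where
  "leaf x = inv_into V D {x}"

lemma leaf: assumes "x \<in> X" shows "leaf x \<in> V" "D (leaf x) = {x}"
proof -
  have "{x} \<in> D ` V" using hierarchyD(5)[OF D_hierarchy assms] .
  then show "leaf x \<in> V" "D (leaf x) = {x}"
    by (simp_all add: leaf_def inv_into_into f_inv_into_f)
qed

lemma D_nonempty: "v \<in> V \<Longrightarrow> D v \<noteq> {}" and D_subset: "v \<in> V \<Longrightarrow> D v \<subseteq> X"
  using hierarchyD(3,4)[OF D_hierarchy] by blast+

text \<open>The singleton of \<open>x\<close> lies strictly below \<open>u\<close>, and the first
  arc of a path to it leads to the desired child.\<close>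

lemma child_above:
  assumes "u \<in> V" "x \<in> D u" "D u \<noteq> {x}"
  obtains c where "(u, c) \<in> E" "x \<in> D c"
proof -
  have x: "x \<in> X" using assms D_subset by blast
  then have "(u, leaf x) \<in> E\<^sup>+" using assms leaf[OF x] by (auto simp: E_trancl)
  then obtain c where c: "(u, c) \<in> E" "(c, leaf x) \<in> E\<^sup>*" by (meson tranclD)
  moreover have "c \<in> V" using c E_iff by blast
  ultimately show thesis using that E_rtrancl[of c "leaf x"] leaf[OF x] by auto
qed

lemma terminal_iff: "v \<in> V \<Longrightarrow> E `` {v} = {} \<longleftrightarrow> (\<exists>x \<in> X. v = leaf x)"
proof
  assume v: "v \<in> V" and no: "E `` {v} = {}"
  obtain x where x: "x \<in> D v" using D_nonempty[OF v] by blast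
  then have "D v = {x}" using child_above[OF v x] no by blast
  moreover have "x \<in> X" using x D_subset[OF v] by blast
  ultimately have "v = leaf x" using leaf[of x] v D_inj by (auto simp: inj_on_def)
  then show "\<exists>x \<in> X. v = leaf x" using \<open>x \<in> X\<close> by blast
next
  assume "v \<in> V" "\<exists>x \<in> X. v = leaf x"
  then obtain x where x: "x \<in> X" "v = leaf x" by blast
  have False if "(v, c) \<in> E" for c
  proof -
    have "c \<in> V" "D c \<subset> {x}" using that leaf[OF x(1)] x(2) by (auto simp: E_iff)
    then show False using D_nonempty by blast
  qed
  then show "E `` {v} = {}" by blast
qed

lemma arborescence_cover: "\<exists>r. branching_arborescence E V r"
proof -
  obtain r where r: "r \<in> V" "D r = X" using hierarchyD(2)[OF D_hierarchy] by auto
  have "branching_arborescence E V r"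
  proof
    show "acyclic E" by (auto simp: acyclic_def E_trancl)
  next
    fix u u' v assume *: "(u, v) \<in> E" "(u', v) \<in> E"
    then have in_V: "u \<in> V" "u' \<in> V" "v \<in> V" by (auto simp: E_iff)
    obtain x where "x \<in> D v" using D_nonempty in_V by blast
    then have "x \<in> D u" "x \<in> D u'" using * by (auto simp: E_iff)
    \<comment> \<open>Both sets contain the nonempty set \<open>D v\<close>, so laminarity makes
      them comparable; strict inclusion either way would contradict that both cover
      \<open>D v\<close>.\<close>
    then have "D u \<subseteq> D u' \<or> D u' \<subseteq> D u"
      using hierarchy_laminar[OF D_hierarchy] in_V by blast
    moreover have "\<not> D u \<subset> D u'" "\<not> D u' \<subset> D u" using * in_V by (auto simp: E_iff)
    ultimately have "D u = D u'" by blast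
    then show "u = u'" using D_inj in_V by (auto simp: inj_on_def)
  next
    show "E \<subseteq> V \<times> V" by (auto simp: E_iff)
  next
    fix v assume "v \<in> V"
    then show "(r, v) \<in> E\<^sup>*" using r D_subset by (simp add: E_rtrancl)
  next
    fix u c assume c: "(u, c) \<in> E"
    then have in_V: "u \<in> V" "c \<in> V" and sub: "D c \<subset> D u" by (auto simp: E_iff)
    \<comment> \<open>A second child comes from a point of \<open>D u\<close> that the first child
      misses.\<close>
    obtain x where x: "x \<in> D u" "x \<notin> D c" using sub by blast
    have "D u \<noteq> {x}"
    proof
      assume "D u = {x}"
      then show False using sub x D_nonempty[OF in_V(2)] by auto
    qed
    then obtain c' where "(u, c') \<in> E" "x \<in> D c'" using child_above in_V x by blast
    then show "\<exists>c'. c' \<noteq> c \<and> (u, c') \<in> E" using x(2) by metis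
  qed (use V_finite r in auto)
  then show ?thesis ..
qed

lemma topological_cover: "topological_tree (cover_graph V D)"
  using arborescence_cover by (simp add: topological_tree_iff cover_graph_def)

lemma finite_E: "finite E"
  using V_finite by (auto intro: finite_subset[of _ "V \<times> V"] simp: cover_graph_def)

lemma leaf_inj: "inj_on leaf X"
  using leaf by (metis inj_onI singleton_inject)

lemma leaves_cover: "leaves (cover_graph V D) = leaf ` X"
proof -
  have "leaves (cover_graph V D) = {v \<in> V. E `` {v} = {}}"
    using leaves_eq[OF finite_E] by (simp add: cover_graph_def)
  also have "\<dots> = {v \<in> V. \<exists>x \<in> X. v = leaf x}" using terminal_iff by blast
  also have "\<dots> = leaf ` X" using leaf(1) by blast
  finally show ?thesis .
qed

lemma cluster_cover: "v \<in> V \<Longrightarrow> cluster E v = leaf ` D v"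
proof (intro set_eqI iffI)
  assume v: "v \<in> V"
  fix l assume l: "l \<in> cluster E v"
  then have "(v, l) \<in> E\<^sup>*" and no: "E `` {l} = {}" by (auto simp: cluster_def)
  then have "l \<in> V" using v E_trancl by (metis rtranclD)
  then obtain x where "x \<in> X" "l = leaf x" using no terminal_iff by blast
  then show "l \<in> leaf ` D v" using \<open>(v, l) \<in> E\<^sup>*\<close> leaf[of x] E_rtrancl[OF v] by auto
next
  assume v: "v \<in> V"
  fix l assume "l \<in> leaf ` D v"
  then obtain x where x: "x \<in> D v" "l = leaf x" by blast
  then have "x \<in> X" using D_subset v by blast
  then show "l \<in> cluster E v"
    using x leaf E_rtrancl[OF v] terminal_iff by (auto simp: cluster_def)
qed

lemma clusters_cover: "cluster E ` V = (`) leaf ` D ` V"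
  using cluster_cover by (auto simp: image_image)

end

section \<open>Passing between trees and hierarchies\<close>

definition tree_hierarchy :: "'a pair_pre_digraph \<Rightarrow> 'a set set" where
  "tree_hierarchy T = cluster (parcs T) ` pverts T"

text \<open>For the count, the trace map is an order isomorphism from the vertices of the induced
  tree onto the restricted family, so both have the same isomorphism type.\<close>

lemma topological_tree_hierarchy:
  assumes "topological_tree T"
  shows "hierarchy (leaves T) (tree_hierarchy T)"
    and "copies S T = card (occurrences S (leaves T) (tree_hierarchy T))"
proof -
  obtain r where "branching_arborescence (parcs T) (pverts T) r"
    using assms unfolding topological_tree_iff ..
  then interpret branching_arborescence "parcs T" "pverts T" r .
  have lv: "leaves T = terminals" by (rule leaves_eq[OF finite_arcs])
  show "hierarchy (leaves T) (tree_hierarchy T)"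
    unfolding hierarchy_def lv
  proof (intro conjI ballI)
    show "terminals \<in> tree_hierarchy T"
      unfolding tree_hierarchy_def cluster_root[symmetric] using root_in by (rule imageI)
  next
    fix l assume l: "l \<in> terminals"
    then have "{l} = cluster (parcs T) l" using cluster_terminal by simp
    then show "{l} \<in> tree_hierarchy T"
      unfolding tree_hierarchy_def using l by (intro image_eqI) auto
  next
    fix A B assume "A \<in> tree_hierarchy T" "B \<in> tree_hierarchy T"
    then obtain u v where uv: "A = cluster (parcs T) u" "B = cluster (parcs T) v"
      by (auto simp: tree_hierarchy_def)
    show "A \<inter> B = {} \<or> A \<subseteq> B \<or> B \<subseteq> A"
    proof (cases "A \<inter> B = {}")
      case False
      then have "(u, v) \<in> (parcs T)\<^sup>* \<or> (v, u) \<in> (parcs T)\<^sup>*"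
        using cluster_meet uv by blast
      then show ?thesis using cluster_mono[of u v] cluster_mono[of v u] uv by blast
    qed simp
  next
    fix A assume "A \<in> tree_hierarchy T"
    then obtain v where v: "v \<in> pverts T" "A = cluster (parcs T) v"
      by (auto simp: tree_hierarchy_def)
    show "A \<noteq> {}" using cluster_nonempty[OF v(1)] v(2) by simp
    show "A \<subseteq> terminals" using cluster_subset[OF v(1)] v(2) by simp
  qed (simp add: finite)
  have "digraph_iso (with_proj (induced_tree T L)) (with_proj S) \<longleftrightarrow>
      digraph_iso (with_proj (hasse (restrict_family (tree_hierarchy T) L))) (with_proj S)"
    if "L \<noteq> {}" "L \<subseteq> leaves T" for L
  proof -
    interpret leaf_selection "parcs T" "pverts T" r L
      using that lv by unfold_locales simp_all
    have "bij_betw tr kept (restrict_family (tree_hierarchy T) L)"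
      using kept_inj tr_kept by (simp add: bij_betw_def tree_hierarchy_def)
    then have "digraph_iso (with_proj (induced_tree T L))
        (with_proj (hasse (restrict_family (tree_hierarchy T) L)))"
      unfolding induced_tree_eq[OF leaf_selection_axioms] by (rule cover_graph_iso) simp
    then show ?thesis
      unfolding induced_tree_eq[OF leaf_selection_axioms]
      by (rule digraph_iso_left_cong[OF wf_cover_graph])
  qed
  then show "copies S T = card (occurrences S (leaves T) (tree_hierarchy T))"
    unfolding copies_def occurrences_def by (simp cong: conj_cong)
qed

lemma hierarchy_realize:
  fixes H :: "'a set set" and S :: "'s pair_pre_digraph"
  assumes H: "hierarchy X H"
  shows "\<exists>T :: nat pair_pre_digraph. topological_tree T \<and> num_leaves T = card X \<and>
    copies S T = card (occurrences S X H)"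
proof -
  \<comment> \<open>The members of \<open>H\<close> are numbered because \<open>max_density\<close>
    ranges over trees on natural numbers; \<open>D\<close> reads off the set that a number stands
    for.\<close>
  obtain g :: "'a set \<Rightarrow> nat" where g: "inj_on g H"
    using hierarchy_finite[OF H] finite_imp_inj_to_nat_seg by blast
  define V where "V = g ` H"
  define D where "D = inv_into H g"
  have DV: "D ` V = H" using g by (simp add: D_def V_def image_image)
  interpret covering V D X
    using DV H g hierarchy_finite[OF H]
    by unfold_locales (auto simp: V_def D_def inj_on_inv_into)
  let ?T = "cover_graph V D"
  have "tree_hierarchy ?T = (`) leaf ` H"
    using clusters_cover DV by (simp add: tree_hierarchy_def cover_graph_def)
  then have "copies S ?T = card (occurrences S X H)"
    using topological_tree_hierarchy(2)[OF topological_cover, of S] leaves_cover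
      occurrences_image[OF leaf_inj, of H S] hierarchyD(4)[OF H] by simp
  moreover have "num_leaves ?T = card X"
    by (simp add: num_leaves_def leaves_cover card_image leaf_inj)
  ultimately show ?thesis using topological_cover by blast
qed

text \<open>The leaves of the Hasse diagram correspond to the points of \<open>L\<close>, and
  isomorphisms preserve the number of leaves.\<close>

lemma occurrences_card:
  assumes "hierarchy X H" "L \<in> occurrences S X H"
  shows "card L = num_leaves S"
proof -
  have H: "hierarchy L (restrict_family H L)"
    using assms hierarchy_restrict by (auto simp: occurrences_def)
  interpret covering "restrict_family H L" "\<lambda>A. A" L
    using H hierarchy_finite[OF H] by unfold_locales auto
  have "num_leaves (hasse (restrict_family H L)) = card L"
    by (simp add: num_leaves_def leaves_cover card_image leaf_inj)
  then show ?thesis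
    using assms(2) num_leaves_iso[OF wf_cover_graph, of "restrict_family H L" "\<lambda>A. A" S]
    by (simp add: occurrences_def)
qed

section \<open>Densities\<close>

lemma num_leaves_positive:
  assumes "topological_tree T"
  shows "num_leaves T \<ge> 1"
proof -
  have H: "hierarchy (leaves T) (tree_hierarchy T)" by (rule topological_tree_hierarchy(1)[OF assms])
  have "finite (leaves T)" "leaves T \<noteq> {}"
    using hierarchyD(1)[OF H] hierarchyD(3)[OF H hierarchyD(2)[OF H]] by simp_all
  then show ?thesis by (simp add: num_leaves_def Suc_le_eq card_gt_0_iff)
qed

lemma occurrences_subset: "occurrences S X H \<subseteq> Pow X"
  by (auto simp: occurrences_def)

lemma finite_occurrences: "finite X \<Longrightarrow> finite (occurrences S X H)"
  using finite_subset[OF occurrences_subset] by simp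

lemma card_occurrences_le:
  assumes "hierarchy X H"
  shows "card (occurrences S X H) \<le> card X choose num_leaves S"
proof -
  have "occurrences S X H \<subseteq> {L. L \<subseteq> X \<and> card L = num_leaves S}"
    using occurrences_card[OF assms] by (auto simp: occurrences_def)
  then have "card (occurrences S X H) \<le> card {L. L \<subseteq> X \<and> card L = num_leaves S}"
    using hierarchyD(1)[OF assms] by (intro card_mono) auto
  then show ?thesis by (simp add: n_subsets[OF hierarchyD(1)[OF assms]])
qed

text \<open>The star shows that every positive number of leaves occurs, so the maximum is over a
  nonempty set.\<close>

lemma hierarchy_star:
  assumes "finite X" "X \<noteq> {}"
  shows "hierarchy X (insert X ((\<lambda>x. {x}) ` X))"
  using assms by (auto simp: hierarchy_def)

definition density_values :: "'s pair_pre_digraph \<Rightarrow> nat \<Rightarrow> real set" where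
  "density_values S n =
    {tree_density S T | T :: nat pair_pre_digraph. topological_tree T \<and> num_leaves T = n}"

lemma density_valuesI:
  assumes "hierarchy X H"
  shows "real (card (occurrences S X H)) / real (card X choose num_leaves S) \<in> density_values S (card X)"
proof -
  obtain T :: "nat pair_pre_digraph"
    where "topological_tree T" "num_leaves T = card X" "copies S T = card (occurrences S X H)"
    using hierarchy_realize[OF assms] by blast
  then show ?thesis by (auto simp: density_values_def tree_density_def intro!: exI[of _ T])
qed

lemma density_valuesE:
  assumes "x \<in> density_values S n"
  obtains X :: "nat set" and H where "hierarchy X H" "card X = n"
    "x = real (card (occurrences S X H)) / real (n choose num_leaves S)"
proof -
  obtain T :: "nat pair_pre_digraph" where T: "topological_tree T" "num_leaves T = n" "x = tree_density S T"
    using assms by (auto simp: density_values_def)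
  show thesis
    using that[OF topological_tree_hierarchy(1)[OF T(1)]] T(2,3)
      topological_tree_hierarchy(2)[OF T(1), of S]
    by (simp add: tree_density_def num_leaves_def)
qed

text \<open>There are infinitely many trees on natural numbers, but their copy counts are bounded by
  a fixed binomial coefficient.\<close>

lemma finite_density_values: "finite (density_values S n)"
proof (rule finite_subset)
  show "density_values S n \<subseteq> (\<lambda>c. real c / real (n choose num_leaves S)) ` {..n choose num_leaves S}"
  proof
    fix x assume "x \<in> density_values S n"
    then show "x \<in> (\<lambda>c. real c / real (n choose num_leaves S)) ` {..n choose num_leaves S}"
      by (rule density_valuesE) (use card_occurrences_le in auto)
  qed
qed simp

lemma density_values_nonempty:
  assumes "n \<ge> 1"
  shows "density_values S n \<noteq> {}"
proof -
  have "hierarchy {..<n} (insert {..<n} ((\<lambda>x. {x}) ` {..<n}))"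
    using assms by (intro hierarchy_star) (auto simp: lessThan_empty_iff)
  from density_valuesI[OF this, of S] show ?thesis by auto
qed

lemma max_density_eq: "max_density S n = Max (density_values S n)"
  by (simp add: max_density_def density_values_def)

lemma max_density_attained:
  assumes "n \<ge> 1"
  obtains X :: "nat set" and H where "hierarchy X H" "card X = n"
    "max_density S n = real (card (occurrences S X H)) / real (n choose num_leaves S)"
proof -
  have "max_density S n \<in> density_values S n"
    using Max_in[OF finite_density_values density_values_nonempty[OF assms]]
    by (simp add: max_density_eq)
  then show thesis by (rule density_valuesE) (rule that)
qed

lemma density_le_max:
  assumes "hierarchy X H"
  shows "real (card (occurrences S X H)) / real (card X choose num_leaves S) \<le> max_density S (card X)"
  unfolding max_density_eq
  using Max_ge[OF finite_density_values density_valuesI[OF assms]] .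

lemma max_density_bounds:
  assumes "n \<ge> 1"
  shows "0 \<le> max_density S n" "max_density S n \<le> 1"
proof -
  obtain X :: "nat set" and H where *: "hierarchy X H" "card X = n"
    "max_density S n = real (card (occurrences S X H)) / real (n choose num_leaves S)"
    using max_density_attained[OF assms] .
  show "0 \<le> max_density S n" using * by simp
  show "max_density S n \<le> 1"
    using *(2,3) card_occurrences_le[OF *(1), of S]
    \<comment> \<open>If \<open>n\<close> is smaller than the number of leaves of \<open>S\<close>,
      the denominator is zero and so is the quotient, by convention.\<close>
    by (cases "n choose num_leaves S = 0") (simp_all add: divide_le_eq_1_pos)
qed

section \<open>Monotonicity by deleting a leaf\<close>

lemma occurrences_delete:
  "occurrences S (X - {v}) (restrict_family H (X - {v})) = {L \<in> occurrences S X H. v \<notin> L}"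
proof -
  have "restrict_family (restrict_family H (X - {v})) L = restrict_family H L" if "L \<subseteq> X" "v \<notin> L" for L
    using that by (intro restrict_restrict) auto
  then show ?thesis by (auto simp: occurrences_def subset_Diff_insert)
qed

text \<open>Pairs of a point \<open>v\<close> and a copy avoiding \<open>v\<close> are counted
  twice. Each copy avoids \<open>Suc n - ?k\<close> points, while the copies avoiding
  \<open>v\<close> live in a hierarchy on \<open>n\<close> points and are bounded by its maximal
  density.\<close>

lemma max_density_Suc:
  assumes k: "1 \<le> num_leaves S" "num_leaves S \<le> n"
  shows "max_density S (Suc n) \<le> max_density S n"
proof -
  let ?k = "num_leaves S"
  obtain X :: "nat set" and H where H: "hierarchy X H" and X: "card X = Suc n"
    and M: "max_density S (Suc n) = real (card (occurrences S X H)) / real (Suc n choose ?k)"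
    using max_density_attained[of "Suc n" S] by auto
  have fin: "finite X" by (rule hierarchyD(1)[OF H])
  let ?O = "occurrences S X H"
  have le: "real (card {L \<in> ?O. v \<notin> L}) \<le> max_density S n * real (n choose ?k)" if v: "v \<in> X" for v
  proof -
    have card: "card (X - {v}) = n" using X v fin by simp
    \<comment> \<open>A hierarchy has a nonempty ground set; here \<open>n\<close> is at least the
      leaf number of \<open>S\<close>, which is positive.\<close>
    have "X - {v} \<noteq> {}"
    proof
      assume "X - {v} = {}"
      then have "card (X - {v}) = 0" by (simp only: card.empty)
      then show False using card k by simp
    qed
    then have "hierarchy (X - {v}) (restrict_family H (X - {v}))"
      using H by (intro hierarchy_restrict) auto
    from density_le_max[OF this, of S] show ?thesis
      using k by (simp add: card occurrences_delete field_simps)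
  qed
  have "card {v \<in> X. v \<notin> L} = Suc n - ?k" if "L \<in> ?O" for L
  proof -
    have "L \<subseteq> X" using that by (simp add: occurrences_def)
    moreover have "card L = ?k" using occurrences_card[OF H that] .
    moreover have "{v \<in> X. v \<notin> L} = X - L" by blast
    ultimately show ?thesis using X fin by (simp add: card_Diff_subset finite_subset)
  qed
  then have multicount: "(\<Sum>v\<in>X. card {L \<in> ?O. v \<notin> L}) = (Suc n - ?k) * card ?O"
    by (intro sum_multicount fin finite_occurrences ballI)
  have "real ((Suc n - ?k) * card ?O) = (\<Sum>v\<in>X. real (card {L \<in> ?O. v \<notin> L}))"
    unfolding multicount[symmetric] by (rule of_nat_sum)
  also have "\<dots> \<le> (\<Sum>v\<in>X. max_density S n * real (n choose ?k))"
    using le by (rule sum_mono)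
  also have "\<dots> = max_density S n * real (Suc n * (n choose ?k))"
    by (simp add: X algebra_simps)
  \<comment> \<open>Both sides count pairs of a \<open>?k\<close>-subset and a point outside it; the
    factor \<open>Suc n - ?k\<close> can then be cancelled.\<close>
  also have "Suc n * (n choose ?k) = (Suc n - ?k) * (Suc n choose ?k)"
    using binomial_absorb_comp[of "Suc n" ?k] by simp
  finally have "real (Suc n - ?k) * real (card ?O)
      \<le> real (Suc n - ?k) * (max_density S n * real (Suc n choose ?k))"
    by (simp only: of_nat_mult mult_ac)
  moreover have "0 < real (Suc n - ?k)" using k by simp
  ultimately have "real (card ?O) \<le> max_density S n * real (Suc n choose ?k)"
    by (simp only: mult_le_cancel_left_pos)
  moreover have "0 < real (Suc n choose ?k)" using k by (simp del: binomial_Suc_Suc)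
  ultimately show ?thesis unfolding M by (simp add: divide_le_eq del: binomial_Suc_Suc)
qed

section \<open>Blowing up the leaves\<close>

text \<open>Applied to a hierarchy, this replaces each leaf \<open>x\<close> by a vertex with
  \<open>m\<close> leaf children, since the singleton of \<open>x\<close> becomes its whole fibre;
  for \<open>m = 1\<close> fibre and leaf coincide.\<close>

definition blow_up :: "'a set \<Rightarrow> 'a set set \<Rightarrow> nat \<Rightarrow> ('a \<times> nat) set set" where
  "blow_up X H m = (\<lambda>A. A \<times> {..<m}) ` H \<union> (\<lambda>y. {y}) ` (X \<times> {..<m})"

lemma hierarchy_blow_up:
  assumes H: "hierarchy X H" and m: "m \<ge> 1"
  shows "hierarchy (X \<times> {..<m}) (blow_up X H m)"
  unfolding hierarchy_def
proof (intro conjI ballI)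
  show "finite (X \<times> {..<m})" using hierarchyD(1)[OF H] by simp
  show "X \<times> {..<m} \<in> blow_up X H m" using hierarchyD(2)[OF H] by (auto simp: blow_up_def)
  fix y assume "y \<in> X \<times> {..<m}"
  then show "{y} \<in> blow_up X H m" by (auto simp: blow_up_def)
next
  fix B assume "B \<in> blow_up X H m"
  then consider A where "A \<in> H" "B = A \<times> {..<m}" | y where "y \<in> X \<times> {..<m}" "B = {y}"
    by (auto simp: blow_up_def)
  then have "B \<noteq> {} \<and> B \<subseteq> X \<times> {..<m}"
    by cases (use hierarchyD(3,4)[OF H] m in \<open>auto simp: lessThan_empty_iff\<close>)
  then show "B \<noteq> {}" "B \<subseteq> X \<times> {..<m}" by auto
next
  fix B C assume "B \<in> blow_up X H m" "C \<in> blow_up X H m"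
  then consider A A' where "A \<in> H" "A' \<in> H" "B = A \<times> {..<m}" "C = A' \<times> {..<m}"
    | y where "B = {y}" | y where "C = {y}"
    unfolding blow_up_def by blast
  then show "B \<inter> C = {} \<or> B \<subseteq> C \<or> C \<subseteq> B"
  proof cases
    case 1
    then have "A \<inter> A' = {} \<or> A \<subseteq> A' \<or> A' \<subseteq> A" using H by (simp add: hierarchy_def)
    then show ?thesis unfolding 1 by blast
  qed auto
qed

text \<open>The chosen set meets each fibre at most once, so an added singleton contributes only a
  trace that the fibre over its point already has.\<close>

lemma restrict_blow_up:
  assumes H: "hierarchy X H" and L: "L \<subseteq> X" and \<phi>: "\<phi> \<in> L \<rightarrow> {..<m}"
  shows "restrict_family (blow_up X H m) ((\<lambda>x. (x, \<phi> x)) ` L) = (`) (\<lambda>x. (x, \<phi> x)) ` restrict_family H L"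
    (is "restrict_family _ (?g ` L) = _")
proof (intro set_eqI iffI)
  fix B assume "B \<in> restrict_family (blow_up X H m) (?g ` L)"
  then obtain C where B: "B \<noteq> {}" "B = C \<inter> ?g ` L" and C: "C \<in> blow_up X H m"
    by (auto simp: restrict_family_iff)
  have "\<exists>A \<in> H. B = ?g ` (A \<inter> L)"
  proof -
    from C consider A where "A \<in> H" "C = A \<times> {..<m}" | y where "C = {y}"
      by (auto simp: blow_up_def)
    then show ?thesis
    proof cases
      case 1
      then have "B = ?g ` (A \<inter> L)" using B \<phi> by auto
      then show ?thesis using 1 by blast
    next
      case 2
      then obtain x where x: "x \<in> L" "y = ?g x" using B by auto
      then have "{x} \<in> H" using L hierarchyD(5)[OF H] by blast
      moreover have "B = ?g ` ({x} \<inter> L)" using x B 2 by auto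
      ultimately show ?thesis by blast
    qed
  qed
  then obtain A where "A \<in> H" "B = ?g ` (A \<inter> L)" by blast
  moreover from this have "A \<inter> L \<in> restrict_family H L" using B by (auto simp: restrict_family_iff)
  ultimately show "B \<in> (`) ?g ` restrict_family H L" by blast
next
  fix B assume "B \<in> (`) ?g ` restrict_family H L"
  then obtain C where "C \<in> restrict_family H L" "B = ?g ` C" by blast
  then obtain A where A: "A \<in> H" "A \<inter> L \<noteq> {}" "B = ?g ` (A \<inter> L)"
    unfolding restrict_family_iff by blast
  then have "B = A \<times> {..<m} \<inter> ?g ` L" using \<phi> by auto
  moreover have "A \<times> {..<m} \<in> blow_up X H m" using A by (auto simp: blow_up_def)
  ultimately show "B \<in> restrict_family (blow_up X H m) (?g ` L)"
    using A unfolding restrict_family_iff by blast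
qed

text \<open>A copy \<open>L\<close> and a choice of one point over each element of \<open>L\<close> give a copy in the blow-up.\<close>

lemma card_occurrences_blow_up:
  assumes H: "hierarchy X H"
  shows "card (occurrences S X H) * m ^ num_leaves S
    \<le> card (occurrences S (X \<times> {..<m}) (blow_up X H m))"
proof -
  \<comment> \<open>The choices are extensional, hence determined by their values on
    \<open>L\<close>; the graph of a choice over \<open>L\<close> then recovers both
    \<open>L\<close> and the choice.\<close>
  let ?P = "Sigma (occurrences S X H) (\<lambda>L. L \<rightarrow>\<^sub>E {..<m})"
  let ?F = "\<lambda>(L, \<phi>). (\<lambda>x. (x, \<phi> x)) ` L"
  have fin: "finite X" using hierarchyD(1)[OF H] .
  have "card (L \<rightarrow>\<^sub>E {..<m}) = m ^ num_leaves S" if "L \<in> occurrences S X H" for L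
  proof -
    have "finite L" using that occurrences_subset[of S X H] fin finite_subset by blast
    then show ?thesis using occurrences_card[OF H that] by (simp add: card_PiE)
  qed
  moreover have "finite (L \<rightarrow>\<^sub>E {..<m})" if "L \<in> occurrences S X H" for L
    using that occurrences_subset[of S X H] fin finite_subset by (intro finite_PiE) blast+
  ultimately have "card (occurrences S X H) * m ^ num_leaves S = card ?P"
    using fin finite_occurrences by (subst card_SigmaI) auto
  also have "\<dots> = card (?F ` ?P)"
  proof (intro card_image[symmetric] inj_onI)
    fix p q assume "p \<in> ?P" "q \<in> ?P" "?F p = ?F q"
    then obtain L \<phi> M \<psi> where pq: "p = (L, \<phi>)" "q = (M, \<psi>)"
      and \<phi>: "\<phi> \<in> L \<rightarrow>\<^sub>E {..<m}" and \<psi>: "\<psi> \<in> M \<rightarrow>\<^sub>E {..<m}"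
      and eq: "(\<lambda>x. (x, \<phi> x)) ` L = (\<lambda>x. (x, \<psi> x)) ` M"
      by auto
    have LM: "L = M" using arg_cong[OF eq, of "(`) fst"] by (simp add: image_image)
    have "\<phi> x = \<psi> x" if "x \<in> L" for x
    proof -
      have "(x, \<phi> x) \<in> (\<lambda>x. (x, \<psi> x)) ` M" using that eq by blast
      then show ?thesis by blast
    qed
    then have "\<phi> = \<psi>" using \<phi> \<psi> LM by (intro PiE_ext) auto
    then show "p = q" using pq LM by simp
  qed
  also have "\<dots> \<le> card (occurrences S (X \<times> {..<m}) (blow_up X H m))"
  proof (rule card_mono)
    show "finite (occurrences S (X \<times> {..<m}) (blow_up X H m))"
      using fin by (intro finite_occurrences) simp
    show "?F ` ?P \<subseteq> occurrences S (X \<times> {..<m}) (blow_up X H m)"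
    proof
      fix M assume "M \<in> ?F ` ?P"
      then obtain L \<phi> where L: "L \<in> occurrences S X H" and \<phi>: "\<phi> \<in> L \<rightarrow>\<^sub>E {..<m}"
        and M: "M = (\<lambda>x. (x, \<phi> x)) ` L"
        by auto
      have LX: "L \<subseteq> X" "L \<noteq> {}"
        and iso: "digraph_iso (with_proj (hasse (restrict_family H L))) (with_proj S)"
        using L by (auto simp: occurrences_def)
      have Pi: "\<phi> \<in> L \<rightarrow> {..<m}" using \<phi> by blast
      have "inj_on (\<lambda>x. (x, \<phi> x)) L" by (rule inj_onI) simp
      then have "digraph_iso (with_proj (hasse (restrict_family H L)))
          (with_proj (hasse ((`) (\<lambda>x. (x, \<phi> x)) ` restrict_family H L)))"
        by (rule hasse_image_iso) (rule restrict_family_subset)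
      from iso[unfolded digraph_iso_left_cong[OF wf_cover_graph this]]
      have "digraph_iso (with_proj (hasse (restrict_family (blow_up X H m) M))) (with_proj S)"
        unfolding M restrict_blow_up[OF H LX(1) Pi] .
      moreover have "M \<noteq> {}" "M \<subseteq> X \<times> {..<m}" using M LX Pi by auto
      ultimately show "M \<in> occurrences S (X \<times> {..<m}) (blow_up X H m)"
        by (simp add: occurrences_def)
    qed
  qed
  finally show ?thesis .
qed

text \<open>The factor \<open>fact k * real (n choose k)\<close> is the falling factorial of
  \<open>n\<close> of length \<open>k\<close>. Multiplying through by \<open>n\<close> avoids a
  division, and each induction step contributes a factor \<open>n - k\<close>.\<close>

lemma falling_factorial_bound:
  fixes n k :: nat
  assumes "k \<le> n"
  shows "real n ^ k * (real n - real k * (real k - 1)) \<le> real n * (fact k * real (n choose k))"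
  using assms
proof (induction k)
  case (Suc k)
  let ?a = "fact k * real (n choose k)"
  have rec: "fact (Suc k) * real (n choose Suc k) = (real n - real k) * ?a"
  proof -
    have "Suc k * (n choose Suc k) = (n - k) * (n choose k)"
      using binomial_absorption[of k n] binomial_absorb_comp[of n k] by simp
    then have "real (Suc k) * real (n choose Suc k) = real (n - k) * real (n choose k)"
      by (metis of_nat_mult)
    then have *: "real (Suc k) * real (n choose Suc k) = (real n - real k) * real (n choose k)"
      using Suc.prems by (simp add: of_nat_diff del: binomial_Suc_Suc)
    have "fact (Suc k) * real (n choose Suc k) = fact k * (real (Suc k) * real (n choose Suc k))"
      by (simp add: mult_ac)
    then show ?thesis unfolding * by (simp add: mult_ac)
  qed
  have IH: "real n ^ k * (real n - real k * (real k - 1)) \<le> real n * ?a" using Suc by simp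
  have k: "0 \<le> real k * (real k * (real k - 1))"
    by (cases "k = 0") auto
  have step: "real n * (real n - real (Suc k) * (real (Suc k) - 1))
      \<le> (real n - real k) * (real n - real k * (real k - 1))"
  proof -
    \<comment> \<open>The gap between the two sides is an explicit sum of two nonnegative
      terms.\<close>
    have "(real n - real k) * (real n - real k * (real k - 1)) - real n * (real n - real (Suc k) * (real (Suc k) - 1))
      = real n * real k + real k * (real k * (real k - 1))"
      by (simp add: algebra_simps)
    moreover have "0 \<le> real n * real k" by simp
    ultimately show ?thesis using k by linarith
  qed
  have "0 \<le> real n ^ k" by simp
  from mult_left_mono[OF step this]
  have "real n ^ Suc k * (real n - real (Suc k) * (real (Suc k) - 1))
      \<le> real n ^ k * ((real n - real k) * (real n - real k * (real k - 1)))"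
    by (simp only: power_Suc mult_ac)
  also have "\<dots> = (real n - real k) * (real n ^ k * (real n - real k * (real k - 1)))"
    by (simp add: mult_ac)
  also have "\<dots> \<le> (real n - real k) * (real n * ?a)"
    using IH Suc.prems by (intro mult_left_mono) auto
  also have "\<dots> = real n * (fact (Suc k) * real (n choose Suc k))"
    unfolding rec by (simp add: mult_ac)
  finally show ?case .
qed simp

text \<open>An optimal hierarchy on \<open>n\<close> points, blown up, competes for the maximum at
  \<open>n * m\<close>. Bounding the binomial coefficient of \<open>n * m\<close> by a power divided
  by a factorial cancels the powers of \<open>m\<close> and leaves a bound that no longer depends on
  \<open>m\<close>.\<close>

lemma max_density_blow_up:
  assumes n: "num_leaves S \<le> n" "1 \<le> n" and m: "1 \<le> m"
  shows "max_density S n * (1 - real (num_leaves S) * (real (num_leaves S) - 1) / real n)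
    \<le> max_density S (n * m)"
proof -
  let ?k = "num_leaves S"
  obtain X :: "nat set" and H where H: "hierarchy X H" and X: "card X = n"
    and M: "max_density S n = real (card (occurrences S X H)) / real (n choose ?k)"
    using max_density_attained[OF n(2), of S] .
  let ?c = "real (card (occurrences S X H))"
  have pos: "0 < real (n choose ?k)" "0 < real (n * m choose ?k)"
    using n m by (auto intro: le_trans)
  have nm: "real n ^ ?k * real m ^ ?k \<ge> fact ?k * real (n * m choose ?k)"
  proof -
    have "real ((n * m choose ?k) * fact ?k) \<le> real ((n * m) ^ ?k)"
      using binomial_fact_pow by (rule of_nat_mono)
    then show ?thesis by (simp add: power_mult_distrib mult.commute)
  qed
  have "real n ^ ?k * (1 - real ?k * (real ?k - 1) / real n) \<le> fact ?k * real (n choose ?k)"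
  proof -
    have "real n * (real n ^ ?k * (1 - real ?k * (real ?k - 1) / real n)) =
        real n ^ ?k * (real n - real ?k * (real ?k - 1))"
      using n by (simp add: field_simps)
    also have "\<dots> \<le> real n * (fact ?k * real (n choose ?k))"
      by (rule falling_factorial_bound[OF n(1)])
    finally show ?thesis using n by simp
  qed
  \<comment> \<open>The factor involving \<open>1 - ...\<close> may be negative; what is multiplied
    in is the density, which is nonnegative.\<close>
  then have "real n ^ ?k * (1 - real ?k * (real ?k - 1) / real n) * max_density S n
      \<le> fact ?k * real (n choose ?k) * max_density S n"
    using max_density_bounds(1)[OF n(2)] by (rule mult_right_mono)
  also have "\<dots> = fact ?k * ?c" unfolding M using pos by simp
  finally have "max_density S n * (1 - real ?k * (real ?k - 1) / real n) \<le> fact ?k * ?c / real n ^ ?k"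
    using n by (simp add: field_simps)
  also have "\<dots> \<le> ?c * real m ^ ?k / real (n * m choose ?k)"
  proof -
    have "?c * (fact ?k * real (n * m choose ?k)) \<le> ?c * (real n ^ ?k * real m ^ ?k)"
      using nm by (rule mult_left_mono) simp
    then show ?thesis using pos(2) n by (simp add: frac_le_eq divide_le_eq le_divide_eq mult_ac)
  qed
  also have "\<dots> \<le> real (card (occurrences S (X \<times> {..<m}) (blow_up X H m))) / real (n * m choose ?k)"
  proof (rule divide_right_mono)
    have "real (card (occurrences S X H) * m ^ ?k)
        \<le> real (card (occurrences S (X \<times> {..<m}) (blow_up X H m)))"
      using card_occurrences_blow_up[OF H] by (rule of_nat_mono)
    then show "?c * real m ^ ?k \<le> real (card (occurrences S (X \<times> {..<m}) (blow_up X H m)))" by simp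
  qed simp
  also have "\<dots> \<le> max_density S (n * m)"
    using density_le_max[OF hierarchy_blow_up[OF H m], of S] by (simp add: card_cartesian_product X)
  finally show ?thesis .
qed

section \<open>Convergence and the error bound\<close>

theorem theorem3:
  fixes S :: "'a pair_pre_digraph"
  assumes "topological_tree S"
  shows "(\<forall>n \<ge> num_leaves S.
            0 \<le> max_density S n - inducibility S \<and>
            max_density S n - inducibility S
              \<le> real (num_leaves S) * (real (num_leaves S) - 1) / real n)
         \<and> (\<lambda>n. max_density S n) \<longlonglongrightarrow> inducibility S"
proof -
  let ?k = "num_leaves S"
  have k: "1 \<le> ?k" using num_leaves_positive[OF assms] .
  \<comment> \<open>Monotonicity starts only at \<open>?k\<close>, so the sequence is shifted to be
    decreasing everywhere; the limit is unaffected.\<close>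
  define f where "f = (\<lambda>i. max_density S (i + ?k))"
  have dec: "decseq f"
    unfolding f_def using max_density_Suc[OF k] by (intro decseq_SucI) simp
  have "0 \<le> f i" for i unfolding f_def using k by (intro max_density_bounds(1)) simp
  then obtain J where J: "f \<longlonglongrightarrow> J" "\<forall>i. J \<le> f i"
    using decseq_convergent[OF dec, of 0] by auto
  have lim: "(\<lambda>n. max_density S n) \<longlonglongrightarrow> J"
    using J(1) unfolding f_def by (rule LIMSEQ_offset)
  then have "(\<lambda>n. ereal (max_density S n)) \<longlonglongrightarrow> ereal J" by simp
  then have "limsup (\<lambda>n. ereal (max_density S n)) = ereal J"
    by (rule lim_imp_Limsup[OF sequentially_bot])
  then have ind: "inducibility S = J" by (simp add: inducibility_def)
  have "0 \<le> max_density S n - J \<and> max_density S n - J \<le> real ?k * (real ?k - 1) / real n"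
    if n: "?k \<le> n" for n
  proof
    have "J \<le> f (n - ?k)" using J(2) by blast
    then show "0 \<le> max_density S n - J" using n by (simp add: f_def)
    have n1: "1 \<le> n" using n k by simp
    let ?e = "real ?k * (real ?k - 1) / real n"
    \<comment> \<open>The multiples of \<open>n\<close> form a subsequence, so the blow-up bound
      passes to the limit \<open>J\<close>.\<close>
    have "filterlim (\<lambda>m. n * m) at_top sequentially"
      using n1 by (intro mult_nat_left_at_top) simp
    then have "(\<lambda>m. max_density S (n * m)) \<longlonglongrightarrow> J"
      using lim by (rule filterlim_compose[rotated])
    then have "max_density S n * (1 - ?e) \<le> J"
    proof (rule LIMSEQ_le_const)
      show "\<exists>N. \<forall>m \<ge> N. max_density S n * (1 - ?e) \<le> max_density S (n * m)"
        using max_density_blow_up[OF n n1] by (intro exI[of _ 1]) simp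
    qed
    \<comment> \<open>The error term is nonnegative as \<open>?k\<close> is at least 1, and the
      density is at most 1.\<close>
    moreover have "max_density S n * ?e \<le> 1 * ?e"
      using max_density_bounds(2)[OF n1] k by (intro mult_right_mono) auto
    ultimately show "max_density S n - J \<le> ?e" by (simp add: algebra_simps)
  qed
  then show ?thesis using lim by (simp add: ind)
qed

end
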